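(* Let $\Omega\subset\mathbb{R}^2$ be a polygon which is tangent-cone graph-like (TCGL) with a given radius $r>0$, and let $L$ be the length of $\partial\Omega$. Then knowing $g(s,r)$, $g_r(s,r)=\frac{\partial g}{\partial r}(s,r)$ and $g_s(s,r)=\frac{\partial g}{\partial s}(s,r)$ for all $s\in[0,L)$ and this particular $r$ is sufficient to completely determine $\Omega$ up to translation and rotation; that is, the side lengths and angles of $\Omega$ can be recovered from these data.
   Context: $\Omega\subset\mathbb{R}^2$ is a compact set whose boundary $\partial\Omega$ is a simple closed curve of length $L$ (here a polygon). $\gamma:[0,L]\to\partial\Omega$ is a continuous arclength parameterization traversing $\partial\Omega$ counterclockwise (interior of $\Omega$ on the left), with $\gamma(0)=\gamma(L)$ and $\gamma$ restricted to $[0,L)$ a bijection onto $\partial\Omega$; the parameter is treated as periodic. $D(p,r)$ is the closed disk of radius $r$ centered at $p$. Integral area invariant: $g(s,r)=\mathrm{Area}(\Omega\cap D(\gamma(s),r))$. Tangent cone: for piecewise $C^1$ $\gamma$, $T_\gamma(s)=\{\alpha\Gamma^-+\beta\Gamma^+ \mid \alpha,\beta\ge 0,\ \alpha+\beta>0\}$, where $\Gamma^-=\lim_{t\uparrow s}\gamma'(t)$ and $\Gamma^+=\lim_{t\downarrow s}\gamma'(t)$. TCGL: $\partial\Omega$ is tangent-cone graph-like at $p=\gamma(s)$ with radius $r$ if for every $w\in T_\gamma(s)$ and every pair of distinct points $u,v\in\partial\Omega\cap D(p,r)$ we have $\langle w,u-v\rangle\neq 0$. $\partial\Omega$ (or $\Omega$)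 is TCGL with radius $r$ if this holds at every $p\in\partial\Omega$. The derivative $g_s$ need not exist at every $s$; "knowing $g_s$ for all $s$" includes knowing at which $s$ it fails to exist. "Determine up to translation and rotation" means: any two TCGL polygons (with the same radius $r$ and the same boundary length $L$) that have, for suitable counterclockwise arclength parameterizations, the same data $g(\cdot,r), g_r(\cdot,r), g_s(\cdot,r)$ on $[0,L)$ differ by a composition of a translation and a rotation of the plane. *)

theory Defs
  imports "HOL-Analysis.Analysis"
begin

fun polygonal_path :: "'a::real_normed_vector list \<Rightarrow> real \<Rightarrow> 'a" where
  "polygonal_path [] = linepath 0 0"
| "polygonal_path [a] = linepath a a"
| "polygonal_path [a, b] = linepath a b"
| "polygonal_path (a # b # c # vs) = linepath a b +++ polygonal_path (b # c # vs)"

(* The vertex list repeats its first vertex at the end; simple_path excludes the degenerate lists.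
   A straight angle at a vertex is allowed. *)
definition polygon :: "(real^2) set \<Rightarrow> bool" where
  "polygon \<Omega> \<longleftrightarrow> compact \<Omega> \<and>
     (\<exists>vs. simple_path (polygonal_path vs) \<and>
           pathfinish (polygonal_path vs) = pathstart (polygonal_path vs) \<and>
           path_image (polygonal_path vs) = frontier \<Omega>)"

definition left_normal :: "real^2 \<Rightarrow> real^2" where
  "left_normal v = vector [- v $ 2, v $ 1]"

(* The parameter is periodic, so \<gamma> is the L-periodic extension to the whole line. Arclength
   parameterization is unit speed; with the bijection onto the frontier it makes L the length of
   the frontier. The last clause says that the interior lies on the left; it also rules out
   that \<Omega> is the bare curve with empty interior. *)
definition ccw_arclength_param :: "(real \<Rightarrow> real^2) \<Rightarrow> real \<Rightarrow> (real^2) set \<Rightarrow> bool" where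
  "ccw_arclength_param \<gamma> L \<Omega> \<longleftrightarrow>
     0 < L \<and>
     continuous_on UNIV \<gamma> \<and>
     (\<forall>s. \<gamma> (s + L) = \<gamma> s) \<and>
     bij_betw \<gamma> {0..<L} (frontier \<Omega>) \<and>
     \<gamma> piecewise_C1_differentiable_on {0..L} \<and>
     (\<forall>s. \<gamma> differentiable (at s) \<longrightarrow> norm (vector_derivative \<gamma> (at s)) = 1) \<and>
     (\<forall>s. \<gamma> differentiable (at s) \<longrightarrow>
        (\<forall>\<^sub>F \<epsilon> in at_right 0.
           \<gamma> s + \<epsilon> *\<^sub>R left_normal (vector_derivative \<gamma> (at s)) \<in> interior \<Omega>))"

definition area_invariant :: "(real^2) set \<Rightarrow> (real \<Rightarrow> real^2) \<Rightarrow> real \<Rightarrow> real \<Rightarrow> real" where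
  "area_invariant \<Omega> \<gamma> s r = measure lebesgue (\<Omega> \<inter> cball (\<gamma> s) r)"

definition tangent_cone :: "(real \<Rightarrow> real^2) \<Rightarrow> real \<Rightarrow> (real^2) set" where
  "tangent_cone \<gamma> s =
     {\<alpha> *\<^sub>R Lim (at_left s) (\<lambda>t. vector_derivative \<gamma> (at t)) +
      \<beta> *\<^sub>R Lim (at_right s) (\<lambda>t. vector_derivative \<gamma> (at t)) | \<alpha> \<beta>.
      0 \<le> \<alpha> \<and> 0 \<le> \<beta> \<and> 0 < \<alpha> + \<beta>}"

definition tcgl_at :: "(real^2) set \<Rightarrow> (real \<Rightarrow> real^2) \<Rightarrow> real \<Rightarrow> real \<Rightarrow> bool" where
  "tcgl_at \<Omega> \<gamma> r s \<longleftrightarrow>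
     (\<forall>w \<in> tangent_cone \<gamma> s.
      \<forall>u \<in> frontier \<Omega> \<inter> cball (\<gamma> s) r. \<forall>v \<in> frontier \<Omega> \<inter> cball (\<gamma> s) r.
        u \<noteq> v \<longrightarrow> w \<bullet> (u - v) \<noteq> 0)"

(* For a parameterization \<gamma> of the frontier, all s means all points of the frontier. *)
definition tcgl :: "(real^2) set \<Rightarrow> (real \<Rightarrow> real^2) \<Rightarrow> real \<Rightarrow> bool" where
  "tcgl \<Omega> \<gamma> r \<longleftrightarrow> (\<forall>s. tcgl_at \<Omega> \<gamma> r s)"

(* Two functions agree in their derivative at x, including in whether it exists. *)
definition same_derivative_at :: "(real \<Rightarrow> real) \<Rightarrow> (real \<Rightarrow> real) \<Rightarrow> real \<Rightarrow> bool" where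
  "same_derivative_at f g x \<longleftrightarrow>
     (\<forall>D. (f has_real_derivative D) (at x) \<longleftrightarrow> (g has_real_derivative D) (at x))"

end

theory Submission
  imports Defs
begin

text \<open>
Why the area data determine the polygon. Fix a boundary point \<open>p = \<gamma> s\<close> with left and right
unit directions \<open>u\<close> and \<open>v\<close>, and write \<open>J\<close> for the quarter turn \<open>left_normal\<close>. The
tangent-cone condition at all the points of the boundary within distance \<open>r\<close> of \<open>p\<close> forbids the
distance to \<open>p\<close> to have an extremum, except at \<open>p\<close>, along the boundary while it is at most \<open>r\<close>. So the boundary crosses
the circle about \<open>p\<close> exactly twice, at a point \<open>a\<close> ahead of \<open>p\<close> and a point \<open>b\<close> behind it
(\<open>two_circle_crossings\<close>), and the condition at \<open>p\<close> itself gives \<open>w \<bullet> (a - b) > 0\<close> for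
\<open>w = u\<close> and \<open>w = v\<close>. The chord from \<open>b\<close> to \<open>a\<close> cuts the circle into an arc in the
interior of \<open>\<Omega>\<close> and an arc outside \<open>\<Omega>\<close> (\<open>chord_separates\<close>).

To first order, moving or inflating the disk only sees \<open>\<Omega>\<close> along the circle, and there \<open>\<Omega>\<close>
looks like the half-plane on the left of the chord: the two sets differ, near the circle, only close to
\<open>a\<close> and \<open>b\<close> (\<open>moving_disk_derivative_local\<close>). Hence the derivatives of the area are those of
a circular segment. Let \<open>n\<close> be the unit vector along \<open>J (a - b)\<close> and let \<open>x r\<close> be the signed distance
from \<open>p\<close> to the chord. With \<open>\<sigma>\<close> the area of a cap of the unit disk, so that
\<open>\<sigma>' x = - 2 sqrt (1 - x\<^sup>2)\<close>, the area has derivative \<open>2 r (\<sigma> x + x sqrt (1 - x\<^sup>2))\<close> in the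
radius and \<open>2 r sqrt (1 - x\<^sup>2) (n \<bullet> \<tau>)\<close> in a direction \<open>\<tau>\<close> of the centre
(\<open>disk_area_derivatives\<close>).

The first expression is strictly decreasing in \<open>x\<close>, so the radial derivative determines \<open>x\<close>. The
one-sided derivatives along the boundary then determine \<open>n \<bullet> u\<close> and \<open>n \<bullet> v\<close>. Since
\<open>n \<bullet> J w\<close> is a positive multiple of \<open>(a - b) \<bullet> w\<close>, it is positive for \<open>w = u\<close> and
\<open>w = v\<close>, so both unit vectors are known in the frame of \<open>n\<close> and \<open>J n\<close>, and therefore the oriented
angle from \<open>u\<close> to \<open>v\<close> is known. For two polygons with equal data, the rotation that takes the one
right direction at \<open>s\<close> to the other thus also takes the one left direction to the other. As directions
are constant on each side of \<open>s\<close>, this rotation does not change with \<open>s\<close>, and the two boundary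
curves are congruent. By the Jordan curve theorem a compact set with nonempty interior is determined by its
frontier when that is a simple closed curve, so the polygons are congruent too.
\<close>

section \<open>The quarter turn of the plane\<close>

lemma left_normal_components [simp]:
  "left_normal v $ 1 = - v $ 2" "left_normal v $ 2 = v $ 1"
  by (auto simp: left_normal_def)

lemmas plane_coords = inner_vec_def sum_2 vec_eq_iff forall_2

lemma inner_left_normal [simp]:
  "left_normal v \<bullet> left_normal w = v \<bullet> w" "left_normal v \<bullet> v = 0" "v \<bullet> left_normal v = 0"
  by (simp_all add: plane_coords algebra_simps)

lemma left_normal_skew: "v \<bullet> left_normal w = - (left_normal v \<bullet> w)"
  by (simp add: plane_coords)

lemma norm_left_normal [simp]: "norm (left_normal v) = norm v"
  by (simp add: norm_eq_sqrt_inner)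

lemma left_normal_linear_simps [simp]:
  "left_normal 0 = 0" "left_normal (v + w) = left_normal v + left_normal w"
  "left_normal (v - w) = left_normal v - left_normal w" "left_normal (c *\<^sub>R v) = c *\<^sub>R left_normal v"
  "left_normal (- v) = - left_normal v" "left_normal (left_normal v) = - v"
  by (simp_all add: plane_coords)

lemma orthonormal_expansion:
  assumes "norm w = 1"
  shows "x = (w \<bullet> x) *\<^sub>R w + (left_normal w \<bullet> x) *\<^sub>R left_normal w"
proof -
  have "w$1 * w$1 + w$2 * w$2 = 1"
    using assms by (simp add: norm_eq_1 plane_coords)
  then have "x$1 = (w$1 * x$1 + w$2 * x$2) * w$1 + (- w$2 * x$1 + w$1 * x$2) * (- w$2)"
    and "x$2 = (w$1 * x$1 + w$2 * x$2) * w$2 + (- w$2 * x$1 + w$1 * x$2) * w$1"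
    by algebra+
  then show ?thesis
    by (simp add: plane_coords)
qed

lemma norm_expansion:
  assumes "norm w = 1"
  shows "(norm x)\<^sup>2 = (w \<bullet> x)\<^sup>2 + (left_normal w \<bullet> x)\<^sup>2"
proof -
  have "w$1 * w$1 + w$2 * w$2 = 1"
    using assms by (simp add: norm_eq_1 plane_coords)
  then have "x$1 * x$1 + x$2 * x$2 = (w$1 * x$1 + w$2 * x$2)\<^sup>2 + (- w$2 * x$1 + w$1 * x$2)\<^sup>2"
    by algebra
  then show ?thesis
    by (simp add: power2_norm_eq_inner plane_coords)
qed

section \<open>Areas of circular segments\<close>

definition unit_cap_area :: "real \<Rightarrow> real" where
  "unit_cap_area c = measure lebesgue (cball 0 1 \<inter> {x :: real^2. c \<le> x $ 2})"

lemma unit_cap_measurable: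
  "cball (0::real^2) 1 \<inter> {x. c \<le> x $ 2} \<in> lmeasurable"
proof -
  have "closed {x::real^2. c \<le> x $ 2}" by (rule closed_halfspace_component_ge_cart)
  then show ?thesis by (intro lmeasurable_compact compact_Int_closed) auto
qed

text \<open>
The similarity of ratio \<open>R\<close> that takes the second axis to \<open>n\<close> and the origin to \<open>p\<close>
turns a cap of the unit disk into the given segment.
\<close>

lemma cap_area_scaling:
  assumes "0 < R" "norm n = 1"
  shows "measure lebesgue (cball p R \<inter> {x :: real^2. e \<le> n \<bullet> x}) =
         R\<^sup>2 * unit_cap_area ((e - n \<bullet> p) / R)"
proof -
  \<comment> \<open>The first axis goes to the clockwise normal of n, so that f preserves orientation.\<close>
  define f where "f = (\<lambda>y::real^2. (- (R * y$1)) *\<^sub>R left_normal n + (R * y$2) *\<^sub>R n)"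
  have lin: "linear f"
    by (rule linearI) (auto simp: f_def algebra_simps)
  have n1: "n$1 * n$1 + n$2 * n$2 = 1"
    using assms by (simp add: norm_eq_1 plane_coords)
  have "det (matrix f) = R\<^sup>2 * (n$1 * n$1 + n$2 * n$2)"
    by (simp add: det_2 matrix_def f_def axis_def power2_eq_square algebra_simps)
  then have det: "\<bar>det (matrix f)\<bar> = R\<^sup>2" using n1 by simp
  have nf: "n \<bullet> f y = R * y$2" for y
  proof -
    have "n \<bullet> f y = R * y$2 * (n \<bullet> n)" by (simp add: f_def inner_add_right inner_diff_right)
    then show ?thesis using assms by (simp add: norm_eq_1)
  qed
  have jf: "left_normal n \<bullet> f y = - R * y$1" for y
  proof -
    have "left_normal n \<bullet> f y = - R * y$1 * (n \<bullet> n)" by (simp add: f_def inner_add_right inner_diff_right)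
    then show ?thesis using assms by (simp add: norm_eq_1)
  qed
  have normf: "norm (f y) = R * norm y" for y
  proof -
    have "(norm (f y))\<^sup>2 = (R * norm y)\<^sup>2"
      by (simp only: norm_expansion[OF assms(2), of "f y"] nf jf power_mult_distrib
            power2_norm_eq_inner[of y]) (simp add: plane_coords algebra_simps power2_eq_square)
    then show ?thesis using assms by (simp add: power2_eq_iff_nonneg)
  qed
  let ?C = "cball 0 1 \<inter> {x :: real^2. (e - n \<bullet> p) / R \<le> x $ 2}"
  have "cball p R \<inter> {x. e \<le> n \<bullet> x} = (+) p ` (f ` ?C)"
  proof (intro equalityI subsetI)
    fix x assume x: "x \<in> cball p R \<inter> {x. e \<le> n \<bullet> x}"
    define y :: "real^2" where "y = vector [- (left_normal n \<bullet> (x - p)) / R, (n \<bullet> (x - p)) / R]"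
    have fy: "f y = x - p"
      using orthonormal_expansion[OF assms(2), of "x - p"] assms(1) by (simp add: f_def y_def)
    have "R * norm y \<le> R" using x normf[of y] fy by (simp add: dist_norm norm_minus_commute)
    moreover have "e - n \<bullet> p \<le> R * y$2" using x nf[of y] fy by (simp add: inner_diff_right)
    ultimately have "y \<in> ?C" using assms(1) by (simp add: divide_le_eq mult.commute)
    moreover have "x = p + f y" using fy by simp
    ultimately show "x \<in> (+) p ` (f ` ?C)" by blast
  next
    fix x assume "x \<in> (+) p ` (f ` ?C)"
    then obtain y where y: "x = p + f y" "norm y \<le> 1" "(e - n \<bullet> p) / R \<le> y $ 2" by auto
    have "dist p x \<le> R"
      using y(2) normf[of y] assms(1) by (simp add: y(1) dist_norm mult_left_le)
    moreover have "e \<le> n \<bullet> x"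
      using y(3) nf[of y] assms(1) by (simp add: y(1) inner_add_right pos_divide_le_eq mult.commute)
    ultimately show "x \<in> cball p R \<inter> {x. e \<le> n \<bullet> x}" by simp
  qed
  then have "measure lebesgue (cball p R \<inter> {x. e \<le> n \<bullet> x}) = measure lebesgue (f ` ?C)"
    by (simp only: measure_translation)
  also have "\<dots> = R\<^sup>2 * unit_cap_area ((e - n \<bullet> p) / R)"
    by (simp add: measure_linear_image[OF lin unit_cap_measurable] det unit_cap_area_def)
  finally show ?thesis .
qed

lemma unit_strip_area:
  assumes "c \<le> d"
  shows "unit_cap_area c - unit_cap_area d = measure lebesgue (cball 0 1 \<inter> {x :: real^2. c \<le> x $ 2 \<and> x $ 2 < d})"
proof -
  have "measure lebesgue ((cball 0 1 \<inter> {x :: real^2. c \<le> x $ 2}) - (cball 0 1 \<inter> {x :: real^2. d \<le> x $ 2}))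
      = unit_cap_area c - unit_cap_area d"
    unfolding unit_cap_area_def using assms
    by (intro measurable_measure_Diff unit_cap_measurable fmeasurableD) auto
  moreover have "(cball 0 1 \<inter> {x :: real^2. c \<le> x $ 2}) - (cball 0 1 \<inter> {x :: real^2. d \<le> x $ 2})
     = cball 0 1 \<inter> {x :: real^2. c \<le> x $ 2 \<and> x $ 2 < d}" by auto
  ultimately show ?thesis by simp
qed

lemma content_box_plane:
  assumes "0 \<le> m" "c \<le> d"
  shows "measure lebesgue (cbox (vector [- m, c] :: real^2) (vector [m, d])) = 2 * m * (d - c)"
proof -
  have "cbox (vector [- m, c] :: real^2) (vector [m, d]) \<noteq> {}"
    using assms by (auto simp: interval_ne_empty_cart forall_2)
  then show ?thesis using assms by (simp add: content_cbox_cart prod_2 UNIV_2)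
qed

text \<open>
Boxes around and inside a thin horizontal strip of the disk bound its area from both sides, which gives
the derivative of the cap area with no integration.
\<close>

lemma unit_strip_area_le:
  assumes "c \<le> d" "0 \<le> M" "\<And>y. c \<le> y \<Longrightarrow> y \<le> d \<Longrightarrow> sqrt (1 - y\<^sup>2) \<le> M"
  shows "unit_cap_area c - unit_cap_area d \<le> 2 * M * (d - c)"
proof -
  have "cball 0 1 \<inter> {x :: real^2. c \<le> x $ 2 \<and> x $ 2 < d} \<subseteq> cbox (vector [- M, c]) (vector [M, d])"
  proof
    fix x :: "real^2" assume x: "x \<in> cball 0 1 \<inter> {x :: real^2. c \<le> x $ 2 \<and> x $ 2 < d}"
    then have "(x$1)\<^sup>2 + (x$2)\<^sup>2 \<le> 1" 
      by (simp add: norm_le_square plane_coords power2_eq_square norm_eq_sqrt_inner)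
    then have "\<bar>x$1\<bar> \<le> sqrt (1 - (x$2)\<^sup>2)" by (simp add: real_le_rsqrt)
    also have "\<dots> \<le> M" using assms x by auto
    finally show "x \<in> cbox (vector [- M, c]) (vector [M, d])"
      using x by (auto simp: mem_box_cart forall_2)
  qed
  then have "measure lebesgue (cball 0 1 \<inter> {x :: real^2. c \<le> x $ 2 \<and> x $ 2 < d}) \<le> 2 * M * (d - c)"
    unfolding content_box_plane[OF assms(2,1), symmetric]
    by (intro measure_mono_fmeasurable) (auto intro!: sets.Int borel_closed sets_completionI_sets)
  then show ?thesis using unit_strip_area[OF assms(1)] by simp
qed

lemma unit_strip_area_ge:
  assumes "c \<le> d" "0 \<le> m" "\<And>y. c \<le> y \<Longrightarrow> y \<le> d \<Longrightarrow> m\<^sup>2 + y\<^sup>2 \<le> 1"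
  shows "2 * m * (d - c) \<le> unit_cap_area c - unit_cap_area d"
proof -
  let ?S = "cball 0 1 \<inter> {x :: real^2. c \<le> x $ 2 \<and> x $ 2 < d}"
  have sub: "cbox (vector [- m, c]) (vector [m, d]) \<subseteq> ?S \<union> {x. x $ 2 = d}"
  proof
    fix x :: "real^2" assume x: "x \<in> cbox (vector [- m, c]) (vector [m, d])"
    then have "- m \<le> x$1" "x$1 \<le> m" "c \<le> x$2" "x$2 \<le> d" by (auto simp: mem_box_cart forall_2)
    then have "(x$1)\<^sup>2 \<le> m\<^sup>2" "m\<^sup>2 + (x$2)\<^sup>2 \<le> 1" using assms by (auto simp: abs_le_square_iff[symmetric])
    then have "(x$1)\<^sup>2 + (x$2)\<^sup>2 \<le> 1" by linarith
    then show "x \<in> ?S \<union> {x. x $ 2 = d}" 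
      using \<open>c \<le> x$2\<close> \<open>x$2 \<le> d\<close> by (auto simp: plane_coords power2_eq_square norm_eq_sqrt_inner)
  qed
  have neg: "negligible {x :: real^2. x $ 2 = d}"
    using negligible_hyperplane[of "axis 2 1 :: real^2" d] by (simp add: inner_axis' axis_eq_0_iff)
  have S: "?S \<in> lmeasurable"
  proof -
    have eq: "?S = (cball 0 1 \<inter> {x :: real^2. c \<le> x $ 2}) - (cball 0 1 \<inter> {x :: real^2. d \<le> x $ 2})"
      by auto
    show ?thesis unfolding eq by (intro fmeasurable.Diff unit_cap_measurable)
  qed
  have "measure lebesgue (cbox (vector [- m, c] :: real^2) (vector [m, d])) \<le> measure lebesgue (?S \<union> {x. x $ 2 = d})"
  proof (rule measure_mono_fmeasurable[OF sub])
    show "?S \<union> {x. x $ 2 = d} \<in> lmeasurable"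
      by (rule fmeasurable.Un[OF S negligible_imp_measurable[OF neg]])
  qed simp
  also have "\<dots> = measure lebesgue ?S"
    using fmeasurableD[OF S] neg unfolding negligible_iff_null_sets by (rule measure_Un_null_set)
  finally show ?thesis unfolding content_box_plane[OF assms(2,1)] unit_strip_area[OF assms(1)] .
qed

lemma has_real_derivative_unit_cap_area:
  assumes "-1 < c" "c < 1"
  shows "(unit_cap_area has_real_derivative - (2 * sqrt (1 - c\<^sup>2))) (at c)"
proof -
  have key: "\<exists>\<delta>>0. \<forall>a b. \<bar>a - c\<bar> < \<delta> \<longrightarrow> \<bar>b - c\<bar> < \<delta> \<longrightarrow> a < b \<longrightarrow>
     \<bar>(unit_cap_area b - unit_cap_area a) / (b - a) + 2 * sqrt (1 - c\<^sup>2)\<bar> \<le> \<epsilon>" if "0 < \<epsilon>" for \<epsilon>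
  proof -
    let ?s = "\<lambda>y::real. sqrt (1 - y\<^sup>2)"
    have "continuous (at c) ?s" by (intro continuous_intros)
    then obtain \<delta> where "0 < \<delta>" and \<delta>: "\<And>y. \<bar>y - c\<bar> < \<delta> \<Longrightarrow> \<bar>?s y - ?s c\<bar> < \<epsilon> / 2"
      using \<open>0 < \<epsilon>\<close> unfolding continuous_at_eps_delta
      by (metis dist_real_def half_gt_zero)
    define \<delta>' where "\<delta>' = min \<delta> (1 - \<bar>c\<bar>)"
    have "0 < \<delta>'" using assms \<open>0 < \<delta>\<close> by (auto simp: \<delta>'_def)
    have "\<bar>(unit_cap_area b - unit_cap_area a) / (b - a) + 2 * ?s c\<bar> \<le> \<epsilon>"
      if ab: "\<bar>a - c\<bar> < \<delta>'" "\<bar>b - c\<bar> < \<delta>'" "a < b" for a b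
    proof -
      have near: "\<bar>y - c\<bar> < \<delta> \<and> y\<^sup>2 < 1" if "a \<le> y" "y \<le> b" for y
        using ab that by (auto simp: \<delta>'_def abs_square_less_1)
      have up: "unit_cap_area a - unit_cap_area b \<le> 2 * (?s c + \<epsilon> / 2) * (b - a)"
      proof (rule unit_strip_area_le)
        show "?s y \<le> ?s c + \<epsilon> / 2" if "a \<le> y" "y \<le> b" for y
          using \<delta>[of y] near[OF that] by linarith
        show "0 \<le> ?s c + \<epsilon> / 2"
          using assms \<open>0 < \<epsilon>\<close> by (simp add: abs_square_le_1)
      qed (use ab in auto)
      have lo: "2 * max 0 (?s c - \<epsilon> / 2) * (b - a) \<le> unit_cap_area a - unit_cap_area b"
      proof (rule unit_strip_area_ge)
        show "(max 0 (?s c - \<epsilon> / 2))\<^sup>2 + y\<^sup>2 \<le> 1" if "a \<le> y" "y \<le> b" for y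
        proof -
          have "0 \<le> ?s y" using near[OF that] by simp
          then have "max 0 (?s c - \<epsilon> / 2) \<le> ?s y" using \<delta>[of y] near[OF that] by linarith
          then have "(max 0 (?s c - \<epsilon> / 2))\<^sup>2 \<le> (?s y)\<^sup>2" by (intro power_mono) auto
          then show ?thesis using near[OF that] by simp
        qed
      qed (use ab in auto)
      have "2 * (?s c - \<epsilon> / 2) * (b - a) \<le> 2 * max 0 (?s c - \<epsilon> / 2) * (b - a)"
        using ab by (intro mult_right_mono mult_left_mono max.cobounded2) auto
      with lo have lo': "2 * (?s c - \<epsilon> / 2) * (b - a) \<le> unit_cap_area a - unit_cap_area b" by linarith
      have "(unit_cap_area b - unit_cap_area a) / (b - a) \<le> - 2 * (?s c - \<epsilon> / 2)"
        using lo' ab by (subst pos_divide_le_eq) (auto simp: algebra_simps)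
      moreover have "- 2 * (?s c + \<epsilon> / 2) \<le> (unit_cap_area b - unit_cap_area a) / (b - a)"
        using up ab by (subst pos_le_divide_eq) (auto simp: algebra_simps)
      ultimately show ?thesis by (simp only: abs_le_iff) argo
    qed
    then show ?thesis using \<open>0 < \<delta>'\<close> by blast
  qed
  have "\<exists>\<delta>>0. \<forall>h. h \<noteq> 0 \<and> \<bar>h\<bar> < \<delta> \<longrightarrow>
      \<bar>(unit_cap_area (c + h) - unit_cap_area c) / h - - (2 * sqrt (1 - c\<^sup>2))\<bar> < \<epsilon>" if "0 < \<epsilon>" for \<epsilon>
  proof -
    obtain \<delta> where "0 < \<delta>" and \<delta>: "\<And>a b. \<bar>a - c\<bar> < \<delta> \<Longrightarrow> \<bar>b - c\<bar> < \<delta> \<Longrightarrow> a < b \<Longrightarrow>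
     \<bar>(unit_cap_area b - unit_cap_area a) / (b - a) + 2 * sqrt (1 - c\<^sup>2)\<bar> \<le> \<epsilon> / 2"
      using key[of "\<epsilon> / 2"] \<open>0 < \<epsilon>\<close> by auto
    have "\<bar>(unit_cap_area (c + h) - unit_cap_area c) / h - - (2 * sqrt (1 - c\<^sup>2))\<bar> \<le> \<epsilon> / 2"
      if "h \<noteq> 0" "\<bar>h\<bar> < \<delta>" for h
    proof (cases "0 < h")
      case True
      then show ?thesis using \<delta>[of c "c + h"] that by auto
    next
      case False
      then have "\<bar>(unit_cap_area c - unit_cap_area (c + h)) / (- h) + 2 * sqrt (1 - c\<^sup>2)\<bar> \<le> \<epsilon> / 2"
        using \<delta>[of "c + h" c] that by auto
      moreover have "(unit_cap_area c - unit_cap_area (c + h)) / (- h) = (unit_cap_area (c + h) - unit_cap_area c) / h"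
        by (simp add: divide_simps)
      ultimately show ?thesis by (simp only: diff_minus_eq_add)
    qed
    then show ?thesis using \<open>0 < \<delta>\<close> \<open>0 < \<epsilon>\<close> by (smt (verit) field_sum_of_halves)
  qed
  then show ?thesis
    unfolding DERIV_def LIM_eq by (auto simp: dist_real_def)
qed

text \<open>
Up to the factor \<open>2 r\<close> this combination is the derivative of a segment area in the radius. Its
own derivative, \<open>- sqrt (1 - x\<^sup>2) - x\<^sup>2 / sqrt (1 - x\<^sup>2)\<close>, is negative.
\<close>

lemma unit_cap_combination_inj:
  assumes "-1 < c" "c < 1" "-1 < d" "d < 1"
    and "unit_cap_area c + c * sqrt (1 - c\<^sup>2) = unit_cap_area d + d * sqrt (1 - d\<^sup>2)"
  shows "c = d"
proof -
  have dec: "unit_cap_area b + b * sqrt (1 - b\<^sup>2) < unit_cap_area a + a * sqrt (1 - a\<^sup>2)"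
    if "-1 < a" "a < b" "b < 1" for a b
  proof (rule DERIV_neg_imp_decreasing[OF \<open>a < b\<close>])
    fix x assume "a \<le> x" "x \<le> b"
    then have x: "-1 < x" "x < 1" using that by auto
    then have pos: "0 < 1 - x\<^sup>2" by (simp add: abs_square_less_1 flip: power2_eq_square)
    have "((\<lambda>x. unit_cap_area x + x * sqrt (1 - x\<^sup>2)) has_real_derivative
       - (2 * sqrt (1 - x\<^sup>2)) + (sqrt (1 - x\<^sup>2) + x * (- x / sqrt (1 - x\<^sup>2)))) (at x)"
      using pos by (auto intro!: derivative_eq_intros has_real_derivative_unit_cap_area x simp: field_simps)
    moreover have "- (2 * sqrt (1 - x\<^sup>2)) + (sqrt (1 - x\<^sup>2) + x * (- x / sqrt (1 - x\<^sup>2))) < 0"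
    proof -
      have "0 < sqrt (1 - x\<^sup>2)" "0 \<le> x * x / sqrt (1 - x\<^sup>2)"
        using pos by (auto intro!: divide_nonneg_pos)
      then have "- sqrt (1 - x\<^sup>2) < x * x / sqrt (1 - x\<^sup>2)" by linarith
      then show ?thesis by simp
    qed
    ultimately show "\<exists>y. ((\<lambda>x. unit_cap_area x + x * sqrt (1 - x\<^sup>2)) has_real_derivative y) (at x) \<and> y < 0"
      by blast
  qed
  show ?thesis using dec[of c d] dec[of d c] assms by linarith
qed

text \<open>
The disk moves with velocity \<open>\<tau>\<close> and grows with speed \<open>\<eta>\<close> while the half-plane stays
fixed; both derivatives used later are instances.
\<close>

lemma cap_area_derivative:
  assumes "0 < r" "norm n = 1" "\<bar>e - n \<bullet> p\<bar> < r"
  defines "x \<equiv> (e - n \<bullet> p) / r"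
  shows "((\<lambda>h. measure lebesgue (cball (p + h *\<^sub>R \<tau>) (r + h * \<eta>) \<inter> {x :: real^2. e \<le> n \<bullet> x}))
      has_real_derivative 2 * r * \<eta> * (unit_cap_area x + x * sqrt (1 - x\<^sup>2)) + 2 * r * sqrt (1 - x\<^sup>2) * (n \<bullet> \<tau>)) (at 0)"
proof -
  have x: "-1 < x" "x < 1" using assms by (auto simp: x_def field_simps)
  let ?G = "\<lambda>h. (r + h * \<eta>)\<^sup>2 * unit_cap_area ((e - n \<bullet> (p + h *\<^sub>R \<tau>)) / (r + h * \<eta>))"
  have "((\<lambda>h. (e - n \<bullet> (p + h *\<^sub>R \<tau>)) / (r + h * \<eta>)) has_real_derivative
     ((- (n \<bullet> \<tau>)) * r - (e - n \<bullet> p) * \<eta>) / (r * r)) (at 0)"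
    using assms(1) unfolding inner_add_right inner_scaleR_right
    by (auto intro!: derivative_eq_intros)
  then have "((\<lambda>h. unit_cap_area ((e - n \<bullet> (p + h *\<^sub>R \<tau>)) / (r + h * \<eta>))) has_real_derivative
     - (2 * sqrt (1 - x\<^sup>2)) * (((- (n \<bullet> \<tau>)) * r - (e - n \<bullet> p) * \<eta>) / (r * r))) (at 0)"
    using has_real_derivative_unit_cap_area[OF x] by (intro DERIV_chain2) (auto simp: x_def)
  then have "(?G has_real_derivative 2 * r * \<eta> * unit_cap_area x
      + r\<^sup>2 * (- (2 * sqrt (1 - x\<^sup>2)) * (((- (n \<bullet> \<tau>)) * r - (e - n \<bullet> p) * \<eta>) / (r * r)))) (at 0)"
    by (auto intro!: derivative_eq_intros simp: x_def)
  moreover have "r\<^sup>2 * (- (2 * sqrt (1 - x\<^sup>2)) * (((- (n \<bullet> \<tau>)) * r - (e - n \<bullet> p) * \<eta>) / (r * r)))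
      = 2 * r * \<eta> * (x * sqrt (1 - x\<^sup>2)) + 2 * r * sqrt (1 - x\<^sup>2) * (n \<bullet> \<tau>)"
  proof -
    have "e - n \<bullet> p = x * r" using assms(1) by (simp add: x_def)
    then show ?thesis using assms(1) by (simp add: power2_eq_square field_simps)
  qed
  ultimately have G: "(?G has_real_derivative 2 * r * \<eta> * (unit_cap_area x + x * sqrt (1 - x\<^sup>2)) + 2 * r * sqrt (1 - x\<^sup>2) * (n \<bullet> \<tau>)) (at 0)"
    by (simp add: algebra_simps)
  have "((\<lambda>h. r + h * \<eta>) \<longlongrightarrow> r + 0 * \<eta>) (nhds 0)" by (intro tendsto_intros filterlim_ident)
  then have "\<forall>\<^sub>F h in nhds 0. 0 < r + h * \<eta>" using assms(1) by (simp add: order_tendstoD)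
  then have "\<forall>\<^sub>F h in nhds 0. ?G h = measure lebesgue (cball (p + h *\<^sub>R \<tau>) (r + h * \<eta>) \<inter> {x :: real^2. e \<le> n \<bullet> x})"
    by eventually_elim (rule cap_area_scaling[symmetric, OF _ assms(2)])
  then show ?thesis using G by (subst (asm) DERIV_cong_ev[OF refl _ refl]) 
qed

section \<open>Disks moving over a fixed region\<close>

lemma annulus_measurable: "{x :: real^2. \<bar>dist p x - r\<bar> \<le> h} \<in> lmeasurable"
proof -
  have "{x :: real^2. \<bar>dist p x - r\<bar> \<le> h} = cball p (r + h) - ball p (r - h)" by auto
  then show ?thesis by (simp add: fmeasurable.Diff)
qed

lemma annulus_area:
  assumes "0 \<le> h" "h \<le> r"
  shows "measure lebesgue {x :: real^2. \<bar>dist p x - r\<bar> \<le> h} = 4 * pi * r * h"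
proof -
  have "{x :: real^2. \<bar>dist p x - r\<bar> \<le> h} = cball p (r + h) - ball p (r - h)" by auto
  moreover have "ball p (r - h) \<subseteq> cball p (r + h)" using assms by auto
  ultimately have "measure lebesgue {x :: real^2. \<bar>dist p x - r\<bar> \<le> h} =
     measure lebesgue (cball p (r + h)) - measure lebesgue (ball p (r - h))"
    using measurable_measure_Diff[of "cball p (r + h)" lebesgue "ball p (r - h)"] by simp
  also have "\<dots> = pi * (r + h)\<^sup>2 - pi * (r - h)\<^sup>2"
    using assms by (simp add: content_cball content_ball unit_ball_vol_2)
  finally show ?thesis by (simp add: power2_eq_square algebra_simps)
qed

text \<open>
The part of a thin annulus near one point of the circle is a small fraction of the annulus: many disjoint
rotated copies of it fit into the annulus, and they all have the same area.
\<close>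

lemma annulus_near_point_area:
  fixes p q :: "real^2"
  assumes "0 < r" "dist p q = r" "0 < \<epsilon>"
  obtains \<eta> where "0 < \<eta>"
    "\<And>h. 0 < h \<Longrightarrow> h \<le> r \<Longrightarrow> measure lebesgue ({x. \<bar>dist p x - r\<bar> \<le> h} \<inter> ball q \<eta>) \<le> \<epsilon> * h"
proof -
  obtain N :: nat where N: "4 * pi * r / \<epsilon> < real N" using reals_Archimedean2 by blast
  have "0 < 4 * pi * r / \<epsilon>" using assms by simp
  with N have "0 < N" by linarith
  have "infinite (sphere p r)"
  proof -
    have "connected (sphere p r)" by (rule connected_sphere) simp
    moreover have "q \<in> sphere p r" "p - (q - p) \<in> sphere p r"
      using assms by (auto simp: dist_norm norm_minus_commute)
    moreover have "q \<noteq> p - (q - p)"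
    proof
      assume "q = p - (q - p)"
      then have "2 *\<^sub>R (q - p) = 0" by (simp add: algebra_simps scaleR_2)
      then show False using assms by auto
    qed
    ultimately show ?thesis
      by (metis connected_finite_iff_sing singletonD empty_iff)
  qed
  then obtain P where P: "finite P" "card P = N" "P \<subseteq> sphere p r"
    using infinite_arbitrarily_large by blast
  obtain \<eta> where "0 < \<eta>" and \<eta>: "\<And>a b. a \<in> P \<Longrightarrow> b \<in> P \<Longrightarrow> a \<noteq> b \<Longrightarrow> 2 * \<eta> \<le> dist a b"
  proof -
    let ?D = "insert 1 ((\<lambda>(a, b). dist a b) ` {(a, b) \<in> P \<times> P. a \<noteq> b})"
    have "finite ?D" using P(1) by (auto intro: finite_subset[OF _ finite_cartesian_product[OF P(1) P(1)]])
    moreover have "\<forall>d\<in>?D. 0 < d" by auto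
    ultimately have "0 < Min ?D" by (subst Min_gr_iff) auto
    moreover have "Min ?D \<le> dist a b" if "a \<in> P" "b \<in> P" "a \<noteq> b" for a b
      using \<open>finite ?D\<close> that by (intro Min_le) auto
    ultimately show ?thesis by (intro that[of "Min ?D / 2"]) auto
  qed
  have "measure lebesgue ({x. \<bar>dist p x - r\<bar> \<le> h} \<inter> ball q \<eta>) \<le> \<epsilon> * h" if "0 < h" "h \<le> r" for h
  proof -
    let ?A = "{x. \<bar>dist p x - r\<bar> \<le> h}"
    let ?m = "measure lebesgue (?A \<inter> ball q \<eta>)"
    have meas: "?A \<inter> ball a \<eta> \<in> lmeasurable" for a
      by (intro fmeasurable.Int annulus_measurable) auto
    have same: "measure lebesgue (?A \<inter> ball a \<eta>) = ?m" if "a \<in> P" for a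
    proof -
      have "norm (q - p) = norm (a - p)"
        using that P(3) assms by (auto simp: dist_norm norm_minus_commute)
      then obtain f where f: "orthogonal_transformation f" "f (q - p) = a - p"
        by (rule orthogonal_transformation_exists)
      have nf: "norm (f x) = norm x" for x using f(1) by (rule orthogonal_transformation_norm)
      have lin: "linear f" using f(1) by (rule orthogonal_transformation_linear)
      have "?A \<inter> ball a \<eta> = (+) p ` f ` (+) (- p) ` (?A \<inter> ball q \<eta>)"
      proof (intro equalityI subsetI)
        fix y assume y: "y \<in> ?A \<inter> ball a \<eta>"
        obtain z where z: "f z = y - p" using orthogonal_transformation_surj[OF f(1)] by (metis surjD)
        have "norm (z + p - p) = norm (y - p)" using nf[of z] z by simp
        moreover have "norm (z - (q - p)) = norm (y - a)"
        proof -
          have "f (z - (q - p)) = y - a" by (simp add: linear_diff[OF lin, of z "q - p"] z f(2))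
          then show ?thesis using nf[of "z - (q - p)"] by simp
        qed
        ultimately have "z + p \<in> ?A \<inter> ball q \<eta>"
          using y by (auto simp: dist_norm norm_minus_commute algebra_simps)
        moreover have "y = p + f (- p + (z + p))" using z by simp
        ultimately show "y \<in> (+) p ` f ` (+) (- p) ` (?A \<inter> ball q \<eta>)" by blast
      next
        fix y assume "y \<in> (+) p ` f ` (+) (- p) ` (?A \<inter> ball q \<eta>)"
        then obtain x where x: "y = p + f (x - p)" "x \<in> ?A \<inter> ball q \<eta>" by auto
        have "norm (y - a) = norm (x - q)"
        proof -
          have "f ((x - p) - (q - p)) = y - a"
            by (simp only: linear_diff[OF lin, of "x - p" "q - p"] f(2) x(1)) simp
          then show ?thesis using nf[of "(x - p) - (q - p)"] by simp
        qed
        then show "y \<in> ?A \<inter> ball a \<eta>"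
          using x nf[of "x - p"] by (auto simp: dist_norm norm_minus_commute)
      qed
      then have "measure lebesgue (?A \<inter> ball a \<eta>) = measure lebesgue (f ` (+) (- p) ` (?A \<inter> ball q \<eta>))"
        by (simp only: measure_translation)
      also have "\<dots> = measure lebesgue ((+) (- p) ` (?A \<inter> ball q \<eta>))"
        by (rule measure_orthogonal_image[OF f(1) measurable_translation[OF meas]])
      also have "\<dots> = ?m" by (rule measure_translation)
      finally show ?thesis .
    qed
    have "real N * ?m = (\<Sum>a\<in>P. measure lebesgue (?A \<inter> ball a \<eta>))"
      using same P(2) by simp
    also have "\<dots> = measure lebesgue (\<Union>a\<in>P. ?A \<inter> ball a \<eta>)"
    proof (rule measure_UNION'[symmetric])
      show "pairwise (\<lambda>a b. disjnt (?A \<inter> ball a \<eta>) (?A \<inter> ball b \<eta>)) P"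
      proof (rule pairwiseI)
        fix a b assume "a \<in> P" "b \<in> P" "a \<noteq> b"
        then have "2 * \<eta> \<le> dist a b" by (rule \<eta>)
        have "False" if "dist a x < \<eta>" "dist b x < \<eta>" for x
          using dist_triangle2[of a b x] that \<open>2 * \<eta> \<le> dist a b\<close> by linarith
        then show "disjnt (?A \<inter> ball a \<eta>) (?A \<inter> ball b \<eta>)"
          by (auto simp: disjnt_iff)
      qed
    qed (use P(1) meas in auto)
    also have "\<dots> \<le> measure lebesgue ?A"
    proof (rule measure_mono_fmeasurable[OF _ _ annulus_measurable])
      show "(\<Union>a\<in>P. ?A \<inter> ball a \<eta>) \<in> sets lebesgue"
        using P(1) fmeasurableD[OF meas] by (rule sets.finite_UN)
    qed blast
    also have "\<dots> = 4 * pi * r * h" using that by (intro annulus_area) auto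
    finally have "real N * ?m \<le> 4 * pi * r * h" .
    moreover have "4 * pi * r * h \<le> real N * (\<epsilon> * h)"
      using N assms that by (simp add: divide_less_eq)
    ultimately have "real N * ?m \<le> real N * (\<epsilon> * h)" by (rule order_trans)
    moreover have "0 < real N" using \<open>0 < N\<close> by simp
    ultimately show ?thesis by (rule mult_left_le_imp_le)
  qed
  then show ?thesis using that \<open>0 < \<eta>\<close> by blast
qed

text \<open>
A set that stays away from all but finitely many points of the circle has area \<open>o(h)\<close> in the annulus
of half-width \<open>h\<close>. By compactness the thin annuli lie in \<open>U\<close> except near the exceptional points,
where the preceding bound applies.
\<close>

lemma annulus_disagreement_negligible:
  fixes p :: "real^2"
  assumes "0 < r" "open U" "finite Q" "Q \<subseteq> sphere p r" "sphere p r - Q \<subseteq> U" "S \<inter> U = {}" "0 < \<epsilon>"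
    and "S \<in> sets lebesgue"
  obtains \<delta> where "0 < \<delta>"
    "\<And>h. 0 < h \<Longrightarrow> h < \<delta> \<Longrightarrow> measure lebesgue (S \<inter> {x. \<bar>dist p x - r\<bar> \<le> h}) \<le> \<epsilon> * h"
proof -
  define \<epsilon>' where "\<epsilon>' = \<epsilon> / (1 + real (card Q))"
  have "0 < \<epsilon>'" using assms(7) by (simp add: \<epsilon>'_def add_pos_nonneg)
  have "\<forall>q\<in>Q. \<exists>\<eta>>0. \<forall>h. 0 < h \<longrightarrow> h \<le> r \<longrightarrow> measure lebesgue ({x. \<bar>dist p x - r\<bar> \<le> h} \<inter> ball q \<eta>) \<le> \<epsilon>' * h"
  proof
    fix q assume "q \<in> Q"
    then have "dist p q = r" using assms(4) by auto
    then show "\<exists>\<eta>>0. \<forall>h. 0 < h \<longrightarrow> h \<le> r \<longrightarrow> measure lebesgue ({x. \<bar>dist p x - r\<bar> \<le> h} \<inter> ball q \<eta>) \<le> \<epsilon>' * h"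
      using annulus_near_point_area[OF assms(1) _ \<open>0 < \<epsilon>'\<close>, of p q] by blast
  qed
  from bchoice[OF this] obtain \<eta> where \<eta>: "\<And>q. q \<in> Q \<Longrightarrow> 0 < \<eta> q"
    "\<And>q h. q \<in> Q \<Longrightarrow> 0 < h \<Longrightarrow> h \<le> r \<Longrightarrow> measure lebesgue ({x. \<bar>dist p x - r\<bar> \<le> h} \<inter> ball q (\<eta> q)) \<le> \<epsilon>' * h"
    by blast
  let ?W = "U \<union> (\<Union>q\<in>Q. ball q (\<eta> q))"
  have "Q \<subseteq> (\<Union>q\<in>Q. ball q (\<eta> q))" using \<eta>(1) by force
  then have cover: "sphere p r \<subseteq> ?W" using assms(5) by blast
  have op: "open ?W" using assms(2) by auto
  obtain \<delta> where "0 < \<delta>" and \<delta>: "(\<Union>x\<in>sphere p r. ball x \<delta>) \<subseteq> ?W"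
    by (rule compact_subset_open_imp_ball_epsilon_subset[OF compact_sphere op cover])
  have "measure lebesgue (S \<inter> {x. \<bar>dist p x - r\<bar> \<le> h}) \<le> \<epsilon> * h" if h: "0 < h" "h < min \<delta> r" for h
  proof -
    let ?A = "{x. \<bar>dist p x - r\<bar> \<le> h}"
    have "?A \<subseteq> ?W"
    proof
      fix x assume x: "x \<in> ?A"
      then have "0 < dist p x" using h by auto
      define y where "y = p + (r / dist p x) *\<^sub>R (x - p)"
      have "y \<in> sphere p r"
        using \<open>0 < dist p x\<close> assms(1) by (simp add: y_def dist_norm norm_minus_commute)
      have "y - x = (r / dist p x - 1) *\<^sub>R (x - p)" by (simp add: y_def algebra_simps)
      then have "dist y x = \<bar>r / dist p x - 1\<bar> * dist p x" by (simp add: dist_norm norm_minus_commute)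
      also have "\<dots> = \<bar>r - dist p x\<bar>"
      proof -
        have "r / dist p x - 1 = (r - dist p x) / dist p x" using \<open>0 < dist p x\<close> by (simp add: diff_divide_distrib)
        then show ?thesis using \<open>0 < dist p x\<close> by (simp add: abs_divide)
      qed
      finally have "dist y x < \<delta>" using x h by auto
      then show "x \<in> ?W" using \<delta> \<open>y \<in> sphere p r\<close> by (meson UN_I mem_ball subsetD)
    qed
    then have "S \<inter> ?A \<subseteq> (\<Union>q\<in>Q. ?A \<inter> ball q (\<eta> q))" using assms(6) by blast
    moreover have "?A \<inter> ball q (\<eta> q) \<in> lmeasurable" for q
      by (intro fmeasurable.Int annulus_measurable) auto
    moreover have "S \<inter> ?A \<in> sets lebesgue"
      using assms(8) fmeasurableD[OF annulus_measurable] by (rule sets.Int)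
    ultimately have "measure lebesgue (S \<inter> ?A) \<le> measure lebesgue (\<Union>q\<in>Q. ?A \<inter> ball q (\<eta> q))"
      using assms(3) by (intro measure_mono_fmeasurable fmeasurable.finite_UN)
    also have "\<dots> \<le> (\<Sum>q\<in>Q. measure lebesgue (?A \<inter> ball q (\<eta> q)))"
      using assms(3) by (intro measure_UNION_le fmeasurableD fmeasurable.Int annulus_measurable) auto
    also have "\<dots> \<le> (\<Sum>q\<in>Q. \<epsilon>' * h)" using \<eta>(2) h by (intro sum_mono) auto
    also have "\<dots> = real (card Q) * \<epsilon>' * h" by simp
    also have "\<dots> \<le> \<epsilon> * h"
      using h assms(7) by (intro mult_right_mono) (auto simp: \<epsilon>'_def field_simps)
    finally show ?thesis .
  qed
  then show ?thesis using that[of "min \<delta> r"] \<open>0 < \<delta>\<close> assms(1) by auto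
qed

text \<open>
Only points that enter or leave the disk, and that belong to exactly one of the two sets, contribute to
the difference of the two area changes.
\<close>

lemma disk_area_change_difference:
  fixes A B D D' :: "(real^2) set"
  assumes [simp]: "A \<in> sets lebesgue" "B \<in> sets lebesgue" "D \<in> lmeasurable" "D' \<in> lmeasurable"
    and "N \<in> lmeasurable" "D - D' \<subseteq> N" "D' - D \<subseteq> N"
  shows "\<bar>(measure lebesgue (A \<inter> D') - measure lebesgue (B \<inter> D')) - (measure lebesgue (A \<inter> D) - measure lebesgue (B \<inter> D))\<bar>
     \<le> measure lebesgue (((A - B) \<union> (B - A)) \<inter> N)"
proof -
  have AD: "X \<inter> Y \<in> lmeasurable" if "X \<in> sets lebesgue" "Y \<in> lmeasurable" for X Y :: "(real^2) set"
    using fmeasurable_Int_fmeasurable[OF that(2,1)] by (simp only: Int_commute)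
  let ?N = "((A - B) \<union> (B - A)) \<inter> N"
  have N: "?N \<in> lmeasurable" by (intro AD sets.Un sets.Diff assms)
  let ?f = "\<lambda>x. (indicator (A \<inter> D') x - indicator (B \<inter> D') x) - (indicator (A \<inter> D) x - indicator (B \<inter> D) x :: real)"
  have int: "integrable lebesgue (indicator X :: _ \<Rightarrow> real)" if "X \<in> lmeasurable" for X :: "(real^2) set"
    using that by (intro integrable_real_indicator fmeasurableD) (auto simp: fmeasurable_def)
  have eq: "(measure lebesgue (A \<inter> D') - measure lebesgue (B \<inter> D')) - (measure lebesgue (A \<inter> D) - measure lebesgue (B \<inter> D)) = integral\<^sup>L lebesgue ?f"
    by (simp add: int AD)
  have "\<bar>integral\<^sup>L lebesgue ?f\<bar> \<le> integral\<^sup>L lebesgue (\<lambda>x. indicator ?N x)"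
  proof (rule integral_abs_bound_integral)
    show "\<bar>?f x\<bar> \<le> indicator ?N x" for x
      using assms(6,7) by (auto simp: indicator_def split: if_splits)
  qed (intro int N Bochner_Integration.integrable_diff AD assms)+
  then show ?thesis using eq by simp
qed

lemma has_real_derivative_zeroI:
  fixes f :: "real \<Rightarrow> real"
  assumes "\<And>\<epsilon>. 0 < \<epsilon> \<Longrightarrow> \<exists>\<delta>>0. \<forall>h. h \<noteq> 0 \<and> \<bar>h\<bar> < \<delta> \<longrightarrow> \<bar>f h - f 0\<bar> \<le> \<epsilon> * \<bar>h\<bar>"
  shows "(f has_real_derivative 0) (at 0)"
proof -
  have "\<exists>s>0. \<forall>h. h \<noteq> 0 \<and> \<bar>h\<bar> < s \<longrightarrow> \<bar>(f h - f 0) / h\<bar> < \<epsilon>" if "0 < \<epsilon>" for \<epsilon>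
  proof -
    obtain \<delta> where "\<delta> > 0" and \<delta>: "\<And>h. h \<noteq> 0 \<and> \<bar>h\<bar> < \<delta> \<Longrightarrow> \<bar>f h - f 0\<bar> \<le> \<epsilon> / 2 * \<bar>h\<bar>"
      using assms[of "\<epsilon> / 2"] \<open>0 < \<epsilon>\<close> by auto
    have "\<bar>(f h - f 0) / h\<bar> \<le> \<epsilon> / 2" if "h \<noteq> 0 \<and> \<bar>h\<bar> < \<delta>" for h
      using \<delta>[OF that] that by (simp add: divide_le_eq)
    moreover have "\<epsilon> / 2 < \<epsilon>" using \<open>0 < \<epsilon>\<close> by simp
    ultimately show ?thesis using \<open>\<delta> > 0\<close> by (meson le_less_trans)
  qed
  then show ?thesis unfolding DERIV_def LIM_eq by simp
qed

text \<open>
The first-order change of the area in a moving disk depends only on the germ of the set along the circle,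
up to finitely many points. This lets a half-plane replace the polygon.
\<close>

lemma moving_disk_derivative_local:
  fixes p :: "real^2"
  assumes "0 < r" and [simp]: "A \<in> sets lebesgue" "B \<in> sets lebesgue"
    and U: "open U" "finite Q" "Q \<subseteq> sphere p r" "sphere p r - Q \<subseteq> U" "A \<inter> U = B \<inter> U"
    and B: "((\<lambda>h. measure lebesgue (B \<inter> cball (p + h *\<^sub>R \<tau>) (r + h * \<eta>))) has_real_derivative D) (at 0)"
  shows "((\<lambda>h. measure lebesgue (A \<inter> cball (p + h *\<^sub>R \<tau>) (r + h * \<eta>))) has_real_derivative D) (at 0)"
proof -
  let ?D = "\<lambda>h. cball (p + h *\<^sub>R \<tau>) (r + h * \<eta>)"
  let ?F = "\<lambda>A h. measure lebesgue (A \<inter> ?D h)"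
  let ?S = "(A - B) \<union> (B - A)"
  \<comment> \<open>C bounds the speed of the disk boundary; the summand 1 keeps C positive.\<close>
  define C where "C = norm \<tau> + \<bar>\<eta>\<bar> + 1"
  have "0 < C" by (simp add: C_def add_nonneg_pos)
  have "((\<lambda>h. ?F A h - ?F B h) has_real_derivative 0) (at 0)"
  proof (rule has_real_derivative_zeroI)
    fix \<epsilon> :: real assume "0 < \<epsilon>"
    then have "0 < \<epsilon> / C" using \<open>0 < C\<close> by simp
    moreover have "?S \<inter> U = {}" using U(5) by blast
    ultimately obtain \<delta> where "0 < \<delta>" and \<delta>: "\<And>h. 0 < h \<Longrightarrow> h < \<delta> \<Longrightarrow>
       measure lebesgue (?S \<inter> {x. \<bar>dist p x - r\<bar> \<le> h}) \<le> \<epsilon> / C * h"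
      using annulus_disagreement_negligible[OF assms(1) U(1-4), of ?S "\<epsilon> / C"] assms(2,3)
      by (metis sets.Diff sets.Un)
    have "\<bar>(?F A h - ?F B h) - (?F A 0 - ?F B 0)\<bar> \<le> \<epsilon> * \<bar>h\<bar>" if h: "h \<noteq> 0" "\<bar>h\<bar> < \<delta> / C" for h
    proof -
      let ?N = "{x. \<bar>dist p x - r\<bar> \<le> C * \<bar>h\<bar>}"
      have "\<bar>(?F A h - ?F B h) - (?F A 0 - ?F B 0)\<bar> \<le> measure lebesgue (?S \<inter> ?N)"
      proof (rule disk_area_change_difference)
        have shift: "\<bar>dist (p + h *\<^sub>R \<tau>) x - dist p x\<bar> \<le> \<bar>h\<bar> * norm \<tau>" for x
          using norm_triangle_ineq3[of "p + h *\<^sub>R \<tau> - x" "p - x"] by (simp add: dist_norm)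
        have Ch: "C * \<bar>h\<bar> = \<bar>h\<bar> * norm \<tau> + \<bar>h * \<eta>\<bar> + \<bar>h\<bar>" by (simp add: C_def abs_mult algebra_simps)
        show "?D 0 - ?D h \<subseteq> ?N" "?D h - ?D 0 \<subseteq> ?N"
          unfolding Ch using shift by (auto simp: abs_le_iff) (smt (verit))+
      qed (auto intro: annulus_measurable)
      also have "\<dots> \<le> \<epsilon> / C * (C * \<bar>h\<bar>)"
        using h \<open>0 < C\<close> by (intro \<delta>) (auto simp: field_simps)
      finally show ?thesis using \<open>0 < C\<close> by simp
    qed
    then show "\<exists>\<delta>>0. \<forall>h. h \<noteq> 0 \<and> \<bar>h\<bar> < \<delta> \<longrightarrow>
        \<bar>(?F A h - ?F B h) - (?F A 0 - ?F B 0)\<bar> \<le> \<epsilon> * \<bar>h\<bar>"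
      using \<open>0 < \<delta>\<close> \<open>0 < C\<close> by (intro exI[of _ "\<delta> / C"]) auto
  qed
  from DERIV_add[OF this B] show ?thesis by simp
qed

section \<open>Arcs and chords of a circle\<close>

text \<open>
Measured from \<open>n\<close>, the angles in \<open>[-pi, pi]\<close> whose cosine exceeds a bound form an interval.
\<close>

lemma circular_arc_connected:
  fixes p n :: "real^2"
  assumes "norm n = 1" "0 < r"
  shows "connected (sphere p r \<inter> {x. e < n \<bullet> x})"
proof -
  have nn: "n \<bullet> n = 1" using assms(1) by (simp add: norm_eq_1)
  define c where "c = (\<lambda>\<theta>. p + (r * cos \<theta>) *\<^sub>R n + (r * sin \<theta>) *\<^sub>R left_normal n)"
  define I where "I = {\<theta>\<in>{-pi..pi}. e - n \<bullet> p < r * cos \<theta>}"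
  have "is_interval I"
    unfolding is_interval_1
  proof (intro ballI allI impI)
    fix a b \<theta> assume *: "a \<in> I" "b \<in> I" "a \<le> \<theta> \<and> \<theta> \<le> b"
    then have ab: "-pi \<le> a" "b \<le> pi" "e - n \<bullet> p < r * cos a" "e - n \<bullet> p < r * cos b" by (auto simp: I_def)
    have "cos \<bar>a\<bar> \<le> cos \<bar>\<theta>\<bar> \<or> cos \<bar>b\<bar> \<le> cos \<bar>\<theta>\<bar>"
      using cos_monotone_0_pi_le[of "\<bar>\<theta>\<bar>" "\<bar>a\<bar>"] cos_monotone_0_pi_le[of "\<bar>\<theta>\<bar>" "\<bar>b\<bar>"] * ab
      by (cases "0 \<le> \<theta>") auto
    then have "cos a \<le> cos \<theta> \<or> cos b \<le> cos \<theta>" by (simp add: cos_abs_real)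
    then have "r * cos a \<le> r * cos \<theta> \<or> r * cos b \<le> r * cos \<theta>" using assms(2) by auto
    then show "\<theta> \<in> I" using * ab by (auto simp: I_def)
  qed
  then have "connected (c ` I)"
    by (intro connected_continuous_image) (auto simp: c_def is_interval_connected_1 intro!: continuous_intros)
  also have "c ` I = sphere p r \<inter> {x. e < n \<bullet> x}"
  proof (intro equalityI subsetI)
    fix x assume "x \<in> c ` I"
    then obtain \<theta> where \<theta>: "\<theta> \<in> I" "x = c \<theta>" by blast
    have "(norm (x - p))\<^sup>2 = r\<^sup>2"
      using sin_cos_squared_add[of \<theta>]
      by (simp add: norm_expansion[OF assms(1)] \<theta>(2) c_def inner_add_right nn left_normal_skew
          power_mult_distrib flip: distrib_left)
    then have "norm (x - p) = r" using assms(2) by (simp add: power2_eq_iff_nonneg)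
    moreover have "n \<bullet> x = n \<bullet> p + r * cos \<theta>" by (simp add: \<theta>(2) c_def inner_add_right nn)
    ultimately show "x \<in> sphere p r \<inter> {x. e < n \<bullet> x}"
      using \<theta>(1) by (auto simp: I_def dist_norm norm_minus_commute)
  next
    fix x assume x: "x \<in> sphere p r \<inter> {x. e < n \<bullet> x}"
    then have "(norm (x - p))\<^sup>2 = r\<^sup>2" by (auto simp: dist_norm norm_minus_commute)
    then have "(n \<bullet> (x - p))\<^sup>2 + (left_normal n \<bullet> (x - p))\<^sup>2 = r\<^sup>2"
      using norm_expansion[OF assms(1), of "x - p"] by simp
    then have "((n \<bullet> (x - p)) / r)\<^sup>2 + ((left_normal n \<bullet> (x - p)) / r)\<^sup>2 = 1"
      using assms(2) by (simp add: power_divide flip: add_divide_distrib)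
    moreover have "\<exists>\<theta>. -pi \<le> \<theta> \<and> \<theta> \<le> pi \<and> a = cos \<theta> \<and> b = sin \<theta>" if "a\<^sup>2 + b\<^sup>2 = 1" for a b :: real
    proof (cases "0 \<le> b")
      case True
      then show ?thesis using sincos_total_pi[OF True that] pi_ge_zero by (smt (verit))
    next
      case False
      have "a\<^sup>2 + (- b)\<^sup>2 = 1" using that by simp
      then obtain t where "0 \<le> t" "t \<le> pi" "a = cos t" "- b = sin t"
        using sincos_total_pi[of "- b" a] False by auto
      then have "-pi \<le> - t \<and> - t \<le> pi \<and> a = cos (- t) \<and> b = sin (- t)" using pi_ge_zero by auto
      then show ?thesis by blast
    qed
    ultimately obtain \<theta> where \<theta>: "-pi \<le> \<theta>" "\<theta> \<le> pi" "(n \<bullet> (x - p)) / r = cos \<theta>" "(left_normal n \<bullet> (x - p)) / r = sin \<theta>"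
      by blast
    then have eqs: "n \<bullet> (x - p) = r * cos \<theta>" "left_normal n \<bullet> (x - p) = r * sin \<theta>"
      using assms(2) by (auto simp: field_simps)
    have "x = c \<theta>"
      using orthonormal_expansion[OF assms(1), of "x - p"] unfolding eqs c_def by (simp add: algebra_simps)
    moreover have "\<theta> \<in> I" using \<theta> eqs(1) x by (auto simp: I_def inner_diff_right)
    ultimately show "x \<in> c ` I" by blast
  qed
  finally show ?thesis .
qed

lemma chord_meets_circle:
  fixes p n :: "real^2"
  assumes "norm n = 1" "a \<in> sphere p r" "b \<in> sphere p r" "x \<in> sphere p r"
    and "n \<bullet> a = e" "n \<bullet> b = e" "n \<bullet> x = e" "a \<noteq> b"
  shows "x = a \<or> x = b"
proof -
  let ?l = "\<lambda>y. left_normal n \<bullet> (y - p)"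
  have sq: "(?l y)\<^sup>2 = r\<^sup>2 - (e - n \<bullet> p)\<^sup>2" if "y \<in> sphere p r" "n \<bullet> y = e" for y
    using norm_expansion[OF assms(1), of "y - p"] that by (simp add: dist_norm norm_minus_commute inner_diff_right)
  have inj: "y = z" if "n \<bullet> y = e" "n \<bullet> z = e" "?l y = ?l z" for y z
  proof -
    have "n \<bullet> (y - p) = n \<bullet> (z - p)" using that by (simp add: inner_diff_right)
    then have "y - p = z - p"
      using orthonormal_expansion[OF assms(1)] that(3) by metis
    then show ?thesis by simp
  qed
  have "?l a \<noteq> ?l b" using inj assms by blast
  moreover have "(?l a)\<^sup>2 = (?l x)\<^sup>2" "(?l b)\<^sup>2 = (?l x)\<^sup>2" using sq assms by auto
  ultimately have "?l x = ?l a \<or> ?l x = ?l b" by (auto simp: power2_eq_iff)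
  then show ?thesis using inj assms by blast
qed

section \<open>Closed curves with the tangent-cone condition\<close>

lemma periodic_int_shift:
  assumes periodic: "\<And>s. \<gamma> (s + L) = \<gamma> s"
  shows "\<gamma> (s + of_int k * (L::real)) = \<gamma> s"
proof (induction k rule: int_induct[where k = 0])
  case (step1 i) then show ?case using periodic[of "s + of_int i * L"] by (simp add: algebra_simps)
next
  case (step2 i) then show ?case using periodic[of "s + of_int (i - 1) * L"] by (simp add: algebra_simps)
qed simp

lemma reduce_to_period:
  fixes L :: real
  assumes "0 < L"
  obtains k :: int where "a \<le> s + of_int k * L" "s + of_int k * L < a + L"
proof
  define k where "k = - \<lfloor>(s - a) / L\<rfloor>"
  have "of_int \<lfloor>(s - a) / L\<rfloor> * L \<le> s - a" "s - a < (of_int \<lfloor>(s - a) / L\<rfloor> + 1) * L"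
    using assms by (simp_all flip: pos_le_divide_eq pos_divide_less_eq)
  then show "a \<le> s + of_int k * L" "s + of_int k * L < a + L"
    by (auto simp: k_def algebra_simps)
qed

text \<open>
The form in which the hypotheses on one polygon are used: \<open>u s\<close> and \<open>v s\<close> are the left and
right directions at \<open>\<gamma> s\<close>, whose nonnegative combinations form the tangent cone.
\<close>

locale graph_like_curve =
  fixes \<Omega> :: "(real^2) set" and \<gamma> u v :: "real \<Rightarrow> real^2" and L r :: real
  assumes closed: "closed \<Omega>" and r_pos: "0 < r" and L_pos: "0 < L"
    and cont: "continuous_on UNIV \<gamma>"
    and periodic: "\<gamma> (s + L) = \<gamma> s"
    and bij: "bij_betw \<gamma> {0..<L} (frontier \<Omega>)"
    and unit: "norm (u s) = 1" "norm (v s) = 1"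
    and straight: "\<exists>\<epsilon>>0. \<forall>h\<in>{0..\<epsilon>}. \<gamma> (s + h) = \<gamma> s + h *\<^sub>R v s \<and> \<gamma> (s - h) = \<gamma> s - h *\<^sub>R u s"
    and cone: "\<lbrakk>0 \<le> \<alpha>; 0 \<le> \<beta>; 0 < \<alpha> + \<beta>; x \<in> frontier \<Omega>; y \<in> frontier \<Omega>;
       x \<in> cball (\<gamma> s) r; y \<in> cball (\<gamma> s) r; x \<noteq> y\<rbrakk> \<Longrightarrow> (\<alpha> *\<^sub>R u s + \<beta> *\<^sub>R v s) \<bullet> (x - y) \<noteq> 0"
    and left: "\<exists>\<epsilon>>0. \<forall>h. 0 < h \<and> h < \<epsilon> \<longrightarrow> 
       (\<forall>\<^sub>F \<delta> in at_right 0. \<gamma> (s + h) + \<delta> *\<^sub>R left_normal (v s) \<in> interior \<Omega>)"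
begin

text \<open>
Were the two signs different, some combination with positive coefficients would be orthogonal to the
difference.
\<close>

lemma cone_sign:
  assumes "x \<in> frontier \<Omega>" "y \<in> frontier \<Omega>" "x \<in> cball (\<gamma> s) r" "y \<in> cball (\<gamma> s) r" "x \<noteq> y"
  shows "0 < (u s \<bullet> (x - y)) * (v s \<bullet> (x - y))"
proof (rule ccontr)
  let ?a = "u s \<bullet> (x - y)" and ?b = "v s \<bullet> (x - y)"
  assume "\<not> 0 < ?a * ?b"
  moreover have ne: "?a \<noteq> 0" "?b \<noteq> 0"
    using cone[of 1 0, OF _ _ _ assms] cone[of 0 1, OF _ _ _ assms] by auto
  ultimately have "?a * ?b < 0" by (simp add: less_le)
  then have "\<bar>?b\<bar> * ?a + \<bar>?a\<bar> * ?b = 0" by (auto simp: abs_if mult_less_0_iff)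
  then show False
    using cone[of "\<bar>?b\<bar>" "\<bar>?a\<bar>", OF _ _ _ assms] ne by (simp add: inner_add_left add_pos_pos)
qed

lemmas periodic_int = periodic_int_shift[where \<gamma> = \<gamma>, OF periodic]
  and reduce_period = reduce_to_period[OF L_pos]

lemma on_frontier: "\<gamma> s \<in> frontier \<Omega>"
proof -
  obtain k :: int where "0 \<le> s + of_int k * L" "s + of_int k * L < 0 + L" by (rule reduce_period)
  then have "\<gamma> (s + of_int k * L) \<in> frontier \<Omega>" using bij by (auto simp: bij_betw_def)
  then show ?thesis by (simp add: periodic_int)
qed

lemma frontier_param:
  assumes "x \<in> frontier \<Omega>"
  obtains t where "s \<le> t" "t < s + L" "x = \<gamma> t"
proof -
  obtain t where "x = \<gamma> t" using assms bij by (auto simp: bij_betw_def)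
  moreover obtain k :: int where "s \<le> t + of_int k * L" "t + of_int k * L < s + L" by (rule reduce_period)
  ultimately show ?thesis using that periodic_int by metis
qed

lemma injective_on_period:
  assumes "s < t" "t < s + L"
  shows "\<gamma> t \<noteq> \<gamma> s"
proof
  assume eq: "\<gamma> t = \<gamma> s"
  obtain k :: int where k: "0 \<le> s + of_int k * L" "s + of_int k * L < 0 + L" by (rule reduce_period)
  obtain j :: int where j: "0 \<le> t + of_int j * L" "t + of_int j * L < 0 + L" by (rule reduce_period)
  have "\<gamma> (s + of_int k * L) = \<gamma> (t + of_int j * L)" using eq by (simp add: periodic_int)
  then have "s + of_int k * L = t + of_int j * L"
    using bij k j by (auto simp: bij_betw_def inj_on_def)
  then have "t - s = of_int (k - j) * L" by (simp add: algebra_simps)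
  then have "0 * L < of_int (k - j) * L" "of_int (k - j) * L < 1 * L" using assms by linarith+
  then have "0 < (of_int (k - j) :: real)" "of_int (k - j) < (1 :: real)"
    using L_pos by (simp_all only: mult_less_cancel_right_pos)
  then have "0 < k - j" "k - j < 1" by (simp_all only: of_int_0_less_iff of_int_less_1_iff)
  then show False by linarith
qed

text \<open>
The cone at \<open>\<gamma> t\<close> is tested against the centre \<open>\<gamma> s\<close>, which lies in the disk about
\<open>\<gamma> t\<close>. So the left and the right derivative of the distance have the same strict sign, also at a
corner.
\<close>

lemma distance_monotone_at:
  assumes "s < t" "t < s + L" "dist (\<gamma> s) (\<gamma> t) \<le> r"
  obtains (inc) \<delta> where "0 < \<delta>" "\<And>h. 0 < h \<Longrightarrow> h < \<delta> \<Longrightarrow> dist (\<gamma> s) (\<gamma> t) < dist (\<gamma> s) (\<gamma> (t + h))"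
      "\<And>h. 0 < h \<Longrightarrow> h < \<delta> \<Longrightarrow> dist (\<gamma> s) (\<gamma> (t - h)) < dist (\<gamma> s) (\<gamma> t)"
  | (dec) \<delta> where "0 < \<delta>" "\<And>h. 0 < h \<Longrightarrow> h < \<delta> \<Longrightarrow> dist (\<gamma> s) (\<gamma> (t + h)) < dist (\<gamma> s) (\<gamma> t)"
      "\<And>h. 0 < h \<Longrightarrow> h < \<delta> \<Longrightarrow> dist (\<gamma> s) (\<gamma> t) < dist (\<gamma> s) (\<gamma> (t - h))"
proof -
  let ?a = "u t \<bullet> (\<gamma> t - \<gamma> s)" and ?b = "v t \<bullet> (\<gamma> t - \<gamma> s)"
  have ab: "0 < ?a * ?b"
    using cone_sign[of "\<gamma> t" "\<gamma> s" t] injective_on_period[OF assms(1,2)] assms(3) r_pos on_frontier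
    by (auto simp: dist_commute)
  obtain \<epsilon> where "0 < \<epsilon>" and \<epsilon>: "\<And>h. 0 \<le> h \<Longrightarrow> h \<le> \<epsilon> \<Longrightarrow> \<gamma> (t + h) = \<gamma> t + h *\<^sub>R v t \<and> \<gamma> (t - h) = \<gamma> t - h *\<^sub>R u t"
    using straight[of t] by auto
  have uu: "u t \<bullet> u t = 1" "v t \<bullet> v t = 1" using unit by (simp_all add: norm_eq_1)
  have step: "(dist a (b + h *\<^sub>R w))\<^sup>2 = (dist a b)\<^sup>2 + h * (2 * (w \<bullet> (b - a)) + h)"
    if "w \<bullet> w = 1" for a b w :: "real^2" and h
    using that by (simp add: dist_norm power2_norm_eq_inner inner_diff_left inner_diff_right
        inner_add_left inner_add_right inner_commute algebra_simps)
  have fwd: "(dist (\<gamma> s) (\<gamma> (t + h)))\<^sup>2 = (dist (\<gamma> s) (\<gamma> t))\<^sup>2 + h * (2 * ?b + h)"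
    and bwd: "(dist (\<gamma> s) (\<gamma> (t - h)))\<^sup>2 = (dist (\<gamma> s) (\<gamma> t))\<^sup>2 - h * (2 * ?a - h)"
    if "0 \<le> h" "h \<le> \<epsilon>" for h
    using step[OF uu(2), of "\<gamma> s" "\<gamma> t" h] step[OF uu(1), of "\<gamma> s" "\<gamma> t" "- h"]
    by (simp_all only: conjunct1[OF \<epsilon>[OF that]] conjunct2[OF \<epsilon>[OF that]]) (simp_all add: algebra_simps)
  have lt: "dist x y < dist z w" if "(dist x y)\<^sup>2 < (dist z w)\<^sup>2" for x y z w :: "real^2"
    using that by (rule power2_less_imp_less) simp
  define \<delta> where "\<delta> = min \<epsilon> (min \<bar>?a\<bar> \<bar>?b\<bar>)"
  have "0 < \<delta>" using \<open>0 < \<epsilon>\<close> ab by (auto simp: \<delta>_def zero_less_mult_iff)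
  show ?thesis
  proof (cases "0 < ?b")
    case True
    with ab have "0 < ?a" by (simp add: zero_less_mult_iff)
    show ?thesis
    proof (rule inc[OF \<open>0 < \<delta>\<close>]; rule lt)
      fix h assume h: "0 < h" "h < \<delta>"
      have "0 < h * (2 * ?b + h)" "0 < h * (2 * ?a - h)"
        using h True \<open>0 < ?a\<close> by (auto simp: \<delta>_def intro!: mult_pos_pos)
      then show "(dist (\<gamma> s) (\<gamma> t))\<^sup>2 < (dist (\<gamma> s) (\<gamma> (t + h)))\<^sup>2" "(dist (\<gamma> s) (\<gamma> (t - h)))\<^sup>2 < (dist (\<gamma> s) (\<gamma> t))\<^sup>2"
        using fwd[of h] bwd[of h] h by (auto simp: \<delta>_def)
    qed
  next
    case False
    with ab have "?a < 0" "?b < 0" by (auto simp: zero_less_mult_iff)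
    show ?thesis
    proof (rule dec[OF \<open>0 < \<delta>\<close>]; rule lt)
      fix h assume h: "0 < h" "h < \<delta>"
      have "h * (2 * ?b + h) < 0" "h * (2 * ?a - h) < 0"
        using h \<open>?a < 0\<close> \<open>?b < 0\<close> by (auto simp: \<delta>_def intro!: mult_pos_neg)
      then show "(dist (\<gamma> s) (\<gamma> (t + h)))\<^sup>2 < (dist (\<gamma> s) (\<gamma> t))\<^sup>2" "(dist (\<gamma> s) (\<gamma> t))\<^sup>2 < (dist (\<gamma> s) (\<gamma> (t - h)))\<^sup>2"
        using fwd[of h] bwd[of h] h by (auto simp: \<delta>_def)
    qed
  qed
qed

lemma continuous_on_dist_curve: "continuous_on S (\<lambda>t. dist (\<gamma> s) (\<gamma> t))"
  using continuous_on_subset[OF cont, of S] by (intro continuous_intros) auto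

lemma no_extremum_within_radius:
  assumes "s \<le> a" "b \<le> s + L" "a < t" "t < b" "dist (\<gamma> s) (\<gamma> t) \<le> r"
  shows "\<exists>t'\<in>{a..b}. dist (\<gamma> s) (\<gamma> t') < dist (\<gamma> s) (\<gamma> t)"
    and "\<exists>t'\<in>{a..b}. dist (\<gamma> s) (\<gamma> t) < dist (\<gamma> s) (\<gamma> t')"
proof -
  let ?P = "(\<exists>t'\<in>{a..b}. dist (\<gamma> s) (\<gamma> t') < dist (\<gamma> s) (\<gamma> t)) \<and>
    (\<exists>t'\<in>{a..b}. dist (\<gamma> s) (\<gamma> t) < dist (\<gamma> s) (\<gamma> t'))"
  have st: "s < t" "t < s + L" using assms by auto
  have "?P"
  proof (cases rule: distance_monotone_at[OF st assms(5), case_names inc dec])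
    case (inc \<delta>)
    define h where "h = min (\<delta> / 2) (min (t - a) (b - t))"
    have "0 < h" "h < \<delta>" "t - h \<in> {a..b}" "t + h \<in> {a..b}" using inc(1) assms by (auto simp: h_def)
    then show ?thesis using inc(2,3) by blast
  next
    case (dec \<delta>)
    define h where "h = min (\<delta> / 2) (min (t - a) (b - t))"
    have "0 < h" "h < \<delta>" "t - h \<in> {a..b}" "t + h \<in> {a..b}" using dec(1) assms by (auto simp: h_def)
    then show ?thesis using dec(2,3) by blast
  qed
  then show "\<exists>t'\<in>{a..b}. dist (\<gamma> s) (\<gamma> t') < dist (\<gamma> s) (\<gamma> t)"
    and "\<exists>t'\<in>{a..b}. dist (\<gamma> s) (\<gamma> t) < dist (\<gamma> s) (\<gamma> t')" by blast+
qed

text \<open>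
The distance from \<open>\<gamma> s\<close> starts and ends at 0 and has no extremum at heights in \<open>(0, r]\<close>, so
its maximum exceeds \<open>r\<close>. A second crossing on the same side of the maximum would create a valley
below \<open>r\<close>.
\<close>

lemma two_circle_crossings:
  obtains t1 t2 where "s < t1" "t1 < t2" "t2 < s + L"
    "dist (\<gamma> s) (\<gamma> t1) = r" "dist (\<gamma> s) (\<gamma> t2) = r"
    "\<forall>t\<in>{s..<t1}. dist (\<gamma> s) (\<gamma> t) < r"
    "\<forall>t\<in>{t2<..s + L}. dist (\<gamma> s) (\<gamma> t) < r"
    "\<forall>t\<in>{s..s + L}. dist (\<gamma> s) (\<gamma> t) = r \<longrightarrow> t = t1 \<or> t = t2"
proof -
  let ?f = "\<lambda>t. dist (\<gamma> s) (\<gamma> t)"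
  have ends: "?f s = 0" "?f (s + L) = 0" by (simp_all add: periodic)
  \<comment> \<open>The minimum over {a..b} would be an interior minimum of the distance at height below r.\<close>
  have no_valley: False
    if "s \<le> a" "a < c" "c < b" "b \<le> s + L" "?f c < ?f a" "?f c < ?f b" "?f c < r" for a b c
  proof -
    have "\<exists>m\<in>{a..b}. \<forall>y\<in>{a..b}. ?f m \<le> ?f y"
      using that by (intro continuous_attains_inf continuous_on_dist_curve) auto
    then obtain m where m: "m \<in> {a..b}" "\<And>y. y \<in> {a..b} \<Longrightarrow> ?f m \<le> ?f y" by blast
    have "?f m \<le> ?f c" using m(2)[of c] that by auto
    moreover have "m \<noteq> a" "m \<noteq> b" using \<open>?f m \<le> ?f c\<close> that by auto
    ultimately have "a < m" "m < b" "?f m \<le> r" using m(1) that by auto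
    then show False using no_extremum_within_radius(1)[of s a b m] that m(2) by force
  qed
  have up: "?f t < r" if "s < c" "c < s + L" "?f c = r" "0 < \<delta>" "\<And>h. 0 < h \<Longrightarrow> h < \<delta> \<Longrightarrow> ?f (c - h) < ?f c"
    "s \<le> t" "t < c" for c t \<delta>
  proof (rule ccontr)
    assume "\<not> ?f t < r"
    have "0 < min \<delta> (c - t)" using that by simp
    then obtain h where "0 < h" "h < min \<delta> (c - t)" by (rule dense[THEN exE]) blast
    then have h: "0 < h" "h < \<delta>" "h < c - t" by simp_all
    then have "?f (c - h) < r" using that by metis
    then show False using no_valley[of t "c - h" c] that h \<open>\<not> ?f t < r\<close> by auto
  qed
  have down: "?f t < r" if "s < c" "c < s + L" "?f c = r" "0 < \<delta>" "\<And>h. 0 < h \<Longrightarrow> h < \<delta> \<Longrightarrow> ?f (c + h) < ?f c"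
    "c < t" "t \<le> s + L" for c t \<delta>
  proof (rule ccontr)
    assume "\<not> ?f t < r"
    have "0 < min \<delta> (t - c)" using that by simp
    then obtain h where "0 < h" "h < min \<delta> (t - c)" by (rule dense[THEN exE]) blast
    then have h: "0 < h" "h < \<delta>" "h < t - c" by simp_all
    then have "?f (c + h) < r" using that by metis
    then show False using no_valley[of c "c + h" t] that h \<open>\<not> ?f t < r\<close> by auto
  qed
  have "\<exists>m\<in>{s..s+L}. \<forall>y\<in>{s..s+L}. ?f y \<le> ?f m"
    using L_pos by (intro continuous_attains_sup continuous_on_dist_curve) auto
  then obtain m where m: "m \<in> {s..s+L}" "\<And>y. y \<in> {s..s+L} \<Longrightarrow> ?f y \<le> ?f m" by blast
  have "0 < ?f (s + L / 2)" using injective_on_period[of s "s + L / 2"] L_pos by auto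
  then have "0 < ?f m" using m(2)[of "s + L / 2"] L_pos by auto
  then have sm: "s < m" "m < s + L" using m(1) ends by (auto simp: less_le)
  have "r < ?f m"
  proof (rule ccontr)
    assume "\<not> r < ?f m"
    then show False using no_extremum_within_radius(2)[of s s "s + L" m] sm m(2) by force
  qed
  obtain t1 where t1: "s \<le> t1" "t1 \<le> m" "?f t1 = r"
    using IVT'[of ?f s r m] ends r_pos \<open>r < ?f m\<close> sm continuous_on_dist_curve by auto
  obtain t2 where t2: "m \<le> t2" "t2 \<le> s + L" "?f t2 = r"
    using IVT2'[of ?f "s + L" r m] ends r_pos \<open>r < ?f m\<close> sm continuous_on_dist_curve by auto
  have t12: "s < t1" "t1 < m" "m < t2" "t2 < s + L"
    using t1 t2 ends r_pos \<open>r < ?f m\<close> by (auto simp: less_le)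
  have before: "?f t < r" if "s \<le> t" "t < c" "s < c" "c < m" "?f c = r" for t c
  proof -
    have c: "s < c" "c < s + L" "?f c \<le> r" using that sm by auto
    show ?thesis
    proof (cases rule: distance_monotone_at[OF c, case_names inc dec])
      case (inc \<delta>) then show ?thesis using up[of c \<delta> t] c that by blast
    next
      case (dec \<delta>)
      then have "?f m < r" using down[of c \<delta> m] c that sm by auto
      then show ?thesis using \<open>r < ?f m\<close> by simp
    qed
  qed
  have after: "?f t < r" if "c < t" "t \<le> s + L" "m < c" "c < s + L" "?f c = r" for t c
  proof -
    have c: "s < c" "c < s + L" "?f c \<le> r" using that sm by auto
    show ?thesis
    proof (cases rule: distance_monotone_at[OF c, case_names inc dec])
      case (dec \<delta>) then show ?thesis using down[of c \<delta> t] c that by blast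
    next
      case (inc \<delta>)
      then have "?f m < r" using up[of c \<delta> m] c that sm by auto
      then show ?thesis using \<open>r < ?f m\<close> by simp
    qed
  qed
  have only: "t = t1 \<or> t = t2" if t: "s \<le> t" "t \<le> s + L" "?f t = r" for t
  proof -
    have "s < t" "t < s + L" "t \<noteq> m" using t ends r_pos \<open>r < ?f m\<close> by (auto simp: less_le)
    then show ?thesis
      using before[of t t1] before[of t1 t] after[of t2 t] after[of t t2] t t1(3) t2(3) t12
      by (metis linorder_neqE_linordered_idom less_irrefl less_imp_le)
  qed
  show ?thesis
    by (rule that[of t1 t2]) (use t12 t1(3) t2(3) before[of _ t1] after[of t2] only in auto)
qed

text \<open>
The cone at the corner is tested against a nearby point of the edge that leaves it: the inner product with
\<open>v s\<close> is positive, hence so is the one with \<open>u s\<close>.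
\<close>

lemma corner_obtuse: "0 < u s \<bullet> v s"
proof -
  obtain \<epsilon> where "0 < \<epsilon>" and \<epsilon>: "\<And>h. 0 \<le> h \<Longrightarrow> h \<le> \<epsilon> \<Longrightarrow> \<gamma> (s + h) = \<gamma> s + h *\<^sub>R v s"
    using straight[of s] by auto
  define h where "h = min \<epsilon> r"
  have h: "0 < h" "h \<le> \<epsilon>" "h \<le> r" using \<open>0 < \<epsilon>\<close> r_pos by (auto simp: h_def)
  have vv: "v s \<bullet> v s = 1" using unit by (simp add: norm_eq_1)
  have eq: "\<gamma> (s + h) - \<gamma> s = h *\<^sub>R v s" using \<epsilon>[of h] h by simp
  have "\<gamma> (s + h) \<noteq> \<gamma> s" using eq h unit(2)[of s] by auto
  moreover have "\<gamma> (s + h) \<in> cball (\<gamma> s) r"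
    using eq h unit(2)[of s] by (simp add: dist_norm norm_minus_commute[of "\<gamma> s"])
  ultimately have "0 < (u s \<bullet> (\<gamma> (s + h) - \<gamma> s)) * (v s \<bullet> (\<gamma> (s + h) - \<gamma> s))"
    using cone_sign[of "\<gamma> (s + h)" "\<gamma> s" s] on_frontier r_pos by auto
  then show ?thesis using h vv unfolding eq by (simp add: zero_less_mult_iff)
qed

lemma nonzero_component:
  assumes "s < t" "t < s + L" "dist (\<gamma> s) (\<gamma> t) \<le> r" "w = u s \<or> w = v s"
  shows "w \<bullet> (\<gamma> t - \<gamma> s) \<noteq> 0"
  using cone_sign[of "\<gamma> t" "\<gamma> s" s] injective_on_period[OF assms(1,2)] assms r_pos on_frontier by auto

text \<open>
While the curve stays in the disk, its component along \<open>u s\<close> or \<open>v s\<close> does not vanish, by the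
condition at \<open>\<gamma> s\<close>, so it keeps the sign that it has close to \<open>\<gamma> s\<close>.
\<close>

lemma positions_before_exit:
  assumes w: "w = u s \<or> w = v s"
  shows "\<lbrakk>s < t; t < s + L; \<And>t'. s < t' \<Longrightarrow> t' \<le> t \<Longrightarrow> dist (\<gamma> s) (\<gamma> t') \<le> r\<rbrakk> \<Longrightarrow> 0 < w \<bullet> (\<gamma> t - \<gamma> s)"
    and "\<lbrakk>s < t; t < s + L; \<And>t'. t \<le> t' \<Longrightarrow> t' < s + L \<Longrightarrow> dist (\<gamma> s) (\<gamma> t') \<le> r\<rbrakk> \<Longrightarrow> w \<bullet> (\<gamma> t - \<gamma> s) < 0"
proof -
  obtain \<epsilon> where "0 < \<epsilon>" and \<epsilon>: "\<And>h. 0 \<le> h \<Longrightarrow> h \<le> \<epsilon> \<Longrightarrow> \<gamma> (s + h) = \<gamma> s + h *\<^sub>R v s \<and> \<gamma> (s - h) = \<gamma> s - h *\<^sub>R u s"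
    using straight[of s] by auto
  have wuv: "0 < w \<bullet> u s" "0 < w \<bullet> v s"
    using w corner_obtuse[of s] unit[of s] by (auto simp: norm_eq_1 inner_commute)
  have cont': "continuous_on S (\<lambda>t. w \<bullet> (\<gamma> t - \<gamma> s))" for S
    using continuous_on_subset[OF cont, of S] by (intro continuous_intros) auto
  { assume t: "s < t" "t < s + L" and le: "\<And>t'. s < t' \<Longrightarrow> t' \<le> t \<Longrightarrow> dist (\<gamma> s) (\<gamma> t') \<le> r"
    show "0 < w \<bullet> (\<gamma> t - \<gamma> s)"
    proof (rule ccontr)
      assume neg: "\<not> 0 < w \<bullet> (\<gamma> t - \<gamma> s)"
      define h where "h = min \<epsilon> (t - s)"
      have h: "0 < h" "h \<le> \<epsilon>" "s + h \<le> t" using \<open>0 < \<epsilon>\<close> t by (auto simp: h_def)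
      have "0 \<le> w \<bullet> (\<gamma> (s + h) - \<gamma> s)" using \<epsilon>[of h] h wuv by simp
      then obtain t' where "s + h \<le> t'" "t' \<le> t" "w \<bullet> (\<gamma> t' - \<gamma> s) = 0"
        using IVT2'[of "\<lambda>t. w \<bullet> (\<gamma> t - \<gamma> s)" t 0 "s + h"] neg h cont' by auto
      then show False using nonzero_component[of s t' w] le t h w by auto
    qed }
  { assume t: "s < t" "t < s + L" and le: "\<And>t'. t \<le> t' \<Longrightarrow> t' < s + L \<Longrightarrow> dist (\<gamma> s) (\<gamma> t') \<le> r"
    show "w \<bullet> (\<gamma> t - \<gamma> s) < 0"
    proof (rule ccontr)
      assume pos: "\<not> w \<bullet> (\<gamma> t - \<gamma> s) < 0"
      define h where "h = min \<epsilon> (s + L - t)"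
      have h: "0 < h" "h \<le> \<epsilon>" "t \<le> s + L - h" using \<open>0 < \<epsilon>\<close> t by (auto simp: h_def)
      have "\<gamma> (s + L - h) = \<gamma> (s - h)" using periodic[of "s - h"] by (simp add: algebra_simps)
      then have "w \<bullet> (\<gamma> (s + L - h) - \<gamma> s) \<le> 0" using \<epsilon>[of h] h wuv by simp
      then obtain t' where "t \<le> t'" "t' \<le> s + L - h" "w \<bullet> (\<gamma> t' - \<gamma> s) = 0"
        using IVT2'[of "\<lambda>t. w \<bullet> (\<gamma> t - \<gamma> s)" "s + L - h" 0 t] pos h cont' by auto
      then show False using nonzero_component[of s t' w] le t h w by auto
    qed }
qed

text \<open>
Over a short initial edge the frontier in the disk is the edge itself: a further point above or below
\<open>\<gamma> (s + h)\<close> would differ from it by a vector orthogonal to \<open>v s\<close>.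
\<close>

lemma frontier_strip:
  assumes "\<And>h. 0 \<le> h \<Longrightarrow> h \<le> \<epsilon> \<Longrightarrow> \<gamma> (s + h) = \<gamma> s + h *\<^sub>R v s" "\<epsilon> \<le> r"
    and "x \<in> frontier \<Omega>" "x \<in> cball (\<gamma> s) r" "0 \<le> v s \<bullet> (x - \<gamma> s)" "v s \<bullet> (x - \<gamma> s) \<le> \<epsilon>"
  shows "left_normal (v s) \<bullet> (x - \<gamma> s) = 0"
proof -
  obtain h where h: "h = v s \<bullet> (x - \<gamma> s)" by blast
  have "0 \<le> h" "h \<le> \<epsilon>" using assms(5,6) h by auto
  then have g: "\<gamma> (s + h) = \<gamma> s + h *\<^sub>R v s" by (rule assms(1))
  have "v s \<bullet> (x - \<gamma> (s + h)) = v s \<bullet> (x - \<gamma> s) - h * (v s \<bullet> v s)"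
    unfolding g by (simp add: inner_diff_right inner_add_right)
  then have orth: "v s \<bullet> (x - \<gamma> (s + h)) = 0"
    using unit(2)[of s] by (simp add: norm_eq_1 flip: h)
  have near: "\<gamma> (s + h) \<in> cball (\<gamma> s) r"
    using \<open>0 \<le> h\<close> \<open>h \<le> \<epsilon>\<close> assms(2) unit(2)[of s] by (simp add: g dist_norm)
  have "x = \<gamma> (s + h)"
  proof (rule ccontr)
    assume "x \<noteq> \<gamma> (s + h)"
    then show False
      using cone[of 0 1 x "\<gamma> (s + h)" s] assms(3,4) on_frontier near orth by simp
  qed
  then have "x - \<gamma> s = h *\<^sub>R v s" using g by simp
  then show ?thesis by (metis inner_left_normal(2) inner_scaleR_right mult_zero_right)
qed

text \<open>
The thin half-strips above and below the initial edge, cut by the disk, are convex and miss the frontier.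
The upper one contains interior points on the left of the edge. If the lower one met \<open>\<Omega>\<close>, both
would lie in \<open>\<Omega>\<close> and the edge would be interior.
\<close>

lemma normal_points_inside_outside:
  shows "\<gamma> s + r *\<^sub>R left_normal (v s) \<in> interior \<Omega>" and "\<gamma> s - r *\<^sub>R left_normal (v s) \<notin> \<Omega>"
proof -
  let ?w = "v s" and ?J = "left_normal (v s)" and ?p = "\<gamma> s"
  have ww: "?w \<bullet> ?w = 1" using unit by (simp add: norm_eq_1)
  obtain \<epsilon>1 where "0 < \<epsilon>1" and \<epsilon>1: "\<And>h. 0 \<le> h \<Longrightarrow> h \<le> \<epsilon>1 \<Longrightarrow> \<gamma> (s + h) = \<gamma> s + h *\<^sub>R v s"
    using straight[of s] by auto
  obtain \<epsilon>2 where "0 < \<epsilon>2" and \<epsilon>2: "\<And>h. 0 < h \<Longrightarrow> h < \<epsilon>2 \<Longrightarrow>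
      \<forall>\<^sub>F \<delta> in at_right 0. \<gamma> (s + h) + \<delta> *\<^sub>R ?J \<in> interior \<Omega>"
    using left[of s] by auto
  define \<epsilon> where "\<epsilon> = min \<epsilon>1 (min \<epsilon>2 r)"
  have "0 < \<epsilon>" and le: "\<epsilon> \<le> \<epsilon>1" "\<epsilon> \<le> \<epsilon>2" "\<epsilon> \<le> r"
    using \<open>0 < \<epsilon>1\<close> \<open>0 < \<epsilon>2\<close> r_pos by (auto simp: \<epsilon>_def)
  define h where "h = \<epsilon> / 2"
  have h: "0 < h" "h < \<epsilon>" "h < r" using \<open>0 < \<epsilon>\<close> le by (auto simp: h_def)
  \<comment> \<open>z is an inner point of the edge, where interior points on the left are available.\<close>
  define z where "z = \<gamma> (s + h)"
  have z: "z = ?p + h *\<^sub>R ?w" using \<epsilon>1[of h] h le by (simp add: z_def)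
  have strip: "?J \<bullet> (x - ?p) = 0"
    if "x \<in> frontier \<Omega>" "x \<in> cball ?p r" "0 \<le> ?w \<bullet> (x - ?p)" "?w \<bullet> (x - ?p) \<le> \<epsilon>" for x
    using frontier_strip[of \<epsilon> s x] \<epsilon>1 le that by auto
  let ?B = "cball ?p r \<inter> {x. ?w \<bullet> ?p \<le> ?w \<bullet> x} \<inter> {x. ?w \<bullet> x \<le> ?w \<bullet> ?p + \<epsilon>}"
  define up where "up = ?B \<inter> {x. ?J \<bullet> ?p < ?J \<bullet> x}"
  define low where "low = ?B \<inter> {x. ?J \<bullet> x < ?J \<bullet> ?p}"
  have conn: "connected up" "connected low"
    unfolding up_def low_def
    by (intro convex_connected convex_Int convex_cball convex_halfspace_le convex_halfspace_ge
        convex_halfspace_lt convex_halfspace_gt)+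
  have disj: "up \<inter> frontier \<Omega> = {}" "low \<inter> frontier \<Omega> = {}"
    using strip by (force simp: up_def low_def inner_diff_right)+
  have sub: "A \<subseteq> interior \<Omega>" if "connected A" "A \<inter> frontier \<Omega> = {}" "A \<inter> \<Omega> \<noteq> {}" for A
    using connected_Int_frontier[of A \<Omega>] that closed by (auto simp: frontier_def closure_closed)
  have "\<forall>\<^sub>F \<delta> in at_right 0. z + \<delta> *\<^sub>R ?J \<in> interior \<Omega>" using \<epsilon>2[of h] h le by (simp add: z_def)
  moreover have "\<forall>\<^sub>F \<delta> in at_right 0. \<delta> < r - h \<and> (0::real) < \<delta>"
    using h by (intro eventually_conj eventually_at_right_less order_tendstoD(2)[OF tendsto_ident_at]) simp_all
  ultimately have "\<forall>\<^sub>F \<delta> in at_right 0. z + \<delta> *\<^sub>R ?J \<in> interior \<Omega> \<and> \<delta> < r - h \<and> 0 < \<delta>"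
    by (rule eventually_conj)
  then obtain \<delta> where \<delta>: "z + \<delta> *\<^sub>R ?J \<in> interior \<Omega>" "\<delta> < r - h" "0 < \<delta>"
    using eventually_happens[of _ "at_right (0::real)"] by auto
  have "dist ?p (z + \<delta> *\<^sub>R ?J) \<le> r"
  proof -
    have "?p - (z + \<delta> *\<^sub>R ?J) = - (h *\<^sub>R ?w + \<delta> *\<^sub>R ?J)" by (simp add: z)
    then have "dist ?p (z + \<delta> *\<^sub>R ?J) = norm (h *\<^sub>R ?w + \<delta> *\<^sub>R ?J)"
      by (simp only: dist_norm norm_minus_cancel)
    also have "\<dots> \<le> h + \<delta>"
      using norm_triangle_ineq[of "h *\<^sub>R ?w" "\<delta> *\<^sub>R ?J"] unit(2)[of s] \<delta> h by simp
    finally show ?thesis using \<delta>(2) by simp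
  qed
  then have "z + \<delta> *\<^sub>R ?J \<in> up"
    using \<delta> h ww by (simp add: up_def z inner_add_right)
  then have up: "up \<subseteq> interior \<Omega>"
    using sub[OF conn(1) disj(1)] \<delta>(1) interior_subset by blast
  have "?p + r *\<^sub>R ?J \<in> up"
    using r_pos ww unit(2)[of s] \<open>0 < \<epsilon>\<close> by (simp add: up_def inner_add_right dist_norm)
  then show "?p + r *\<^sub>R ?J \<in> interior \<Omega>" using up by blast
  show "?p - r *\<^sub>R ?J \<notin> \<Omega>"
  proof
    assume "?p - r *\<^sub>R ?J \<in> \<Omega>"
    moreover have "?p - r *\<^sub>R ?J \<in> low"
      using r_pos ww unit(2)[of s] \<open>0 < \<epsilon>\<close> by (simp add: low_def inner_diff_right dist_norm)
    ultimately have low: "low \<subseteq> interior \<Omega>" using sub[OF conn(2) disj(2)] by blast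
    define \<rho> where "\<rho> = min h (r - h)"
    have "ball z \<rho> \<subseteq> \<Omega>"
    proof
      fix x assume x: "x \<in> ball z \<rho>"
      have "\<bar>?w \<bullet> (x - z)\<bar> < \<rho>"
        using Cauchy_Schwarz_ineq2[of ?w "x - z"] unit(2)[of s] x by (auto simp: dist_norm norm_minus_commute)
      moreover have "?w \<bullet> (x - z) = ?w \<bullet> x - ?w \<bullet> ?p - h" using ww by (simp add: z inner_diff_right inner_add_right)
      moreover have "\<rho> \<le> h" by (simp add: \<rho>_def)
      moreover have "\<epsilon> = 2 * h" by (simp add: h_def)
      ultimately have wx: "0 \<le> ?w \<bullet> (x - ?p)" "?w \<bullet> (x - ?p) \<le> \<epsilon>"
        unfolding inner_diff_right by linarith+
      have "dist ?p z = h" using h(1) unit(2)[of s] by (simp add: z dist_norm)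
      moreover have "dist z x < r - h" using x by (simp add: \<rho>_def)
      ultimately have "dist ?p x \<le> r" using dist_triangle[of ?p x z] by linarith
      then have "x \<in> ?B" using wx by (simp add: inner_diff_right)
      then consider "x \<in> up" | "x \<in> low" | "?J \<bullet> (x - ?p) = 0"
        unfolding up_def low_def inner_diff_right by (cases "?J \<bullet> ?p" "?J \<bullet> x" rule: linorder_cases) auto
      then show "x \<in> \<Omega>"
      proof cases
        case 3
        then have "x - ?p = (?w \<bullet> (x - ?p)) *\<^sub>R ?w"
          using orthonormal_expansion[OF unit(2)[of s], of "x - ?p"] by simp
        moreover have "\<gamma> (s + ?w \<bullet> (x - ?p)) = ?p + (?w \<bullet> (x - ?p)) *\<^sub>R ?w"
          using wx le by (intro \<epsilon>1) auto
        ultimately have "x = \<gamma> (s + ?w \<bullet> (x - ?p))" by (simp only:) (metis add_diff_cancel_left' diff_add_cancel add.commute)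
        then show ?thesis using on_frontier closed by (metis frontier_subset_closed subsetD)
      qed (use up low interior_subset in blast)+
    qed
    then have "z \<in> interior \<Omega>" using h by (intro interiorI[of "ball z \<rho>"]) (auto simp: \<rho>_def)
    then show False using on_frontier[of "s + h"] by (simp add: z_def frontier_def)
  qed
qed

text \<open>
Each open arc cut off by the chord is connected and misses the frontier, so it lies in the interior of \<open>\<Omega>\<close> or
outside \<open>\<Omega>\<close>.
The two points of the circle on the normal to \<open>v s\<close> at \<open>\<gamma> s\<close> are one on each arc and decide
which side.
\<close>

lemma chord_separates:
  obtains a b where "a \<in> sphere (\<gamma> s) r" "b \<in> sphere (\<gamma> s) r" "a \<noteq> b"
    "0 < u s \<bullet> (a - b)" "0 < v s \<bullet> (a - b)"
    "\<And>x. x \<in> sphere (\<gamma> s) r \<Longrightarrow> 0 < left_normal (a - b) \<bullet> (x - a) \<Longrightarrow> x \<in> interior \<Omega>"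
    "\<And>x. x \<in> sphere (\<gamma> s) r \<Longrightarrow> left_normal (a - b) \<bullet> (x - a) < 0 \<Longrightarrow> x \<notin> \<Omega>"
proof -
  let ?p = "\<gamma> s" and ?w = "v s"
  obtain t1 t2 where t: "s < t1" "t1 < t2" "t2 < s + L"
    "dist ?p (\<gamma> t1) = r" "dist ?p (\<gamma> t2) = r"
    "\<forall>t\<in>{s..<t1}. dist ?p (\<gamma> t) < r"
    "\<forall>t\<in>{t2<..s + L}. dist ?p (\<gamma> t) < r"
    "\<forall>t\<in>{s..s + L}. dist ?p (\<gamma> t) = r \<longrightarrow> t = t1 \<or> t = t2"
    by (rule two_circle_crossings[of s]) blast
  define a where "a = \<gamma> t1"
  define b where "b = \<gamma> t2"
  have pos: "0 < w \<bullet> (a - ?p)" "w \<bullet> (b - ?p) < 0" if "w = u s \<or> w = v s" for w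
  proof -
    show "0 < w \<bullet> (a - ?p)" unfolding a_def
      using t by (intro positions_before_exit(1)[OF that]) (auto simp: less_le)
    show "w \<bullet> (b - ?p) < 0" unfolding b_def
      using t by (intro positions_before_exit(2)[OF that]) (auto simp: less_le)
  qed
  have wab: "0 < w \<bullet> (a - b)" if "w = u s \<or> w = v s" for w
    using pos[OF that] by (simp add: inner_diff_right)
  then have "a \<noteq> b" by force
  have ab: "a \<in> sphere ?p r" "b \<in> sphere ?p r" using t by (auto simp: a_def b_def)
  define V where "V = left_normal (a - b)"
  have "V \<noteq> 0" using \<open>a \<noteq> b\<close> norm_left_normal[of "a - b"] by (auto simp: V_def)
  define n where "n = V /\<^sub>R norm V"
  have "norm n = 1" using \<open>V \<noteq> 0\<close> by (simp add: n_def)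
  define e where "e = n \<bullet> a"
  have "n \<bullet> b = e"
  proof -
    have "V \<bullet> (a - b) = 0" unfolding V_def by (rule inner_left_normal(2))
    then show ?thesis by (simp add: e_def n_def inner_diff_right)
  qed
  have side: "e < n \<bullet> x \<longleftrightarrow> 0 < V \<bullet> (x - a)" "n \<bullet> x < e \<longleftrightarrow> V \<bullet> (x - a) < 0" for x
    using \<open>V \<noteq> 0\<close> by (simp_all add: e_def n_def inner_diff_right divide_inverse_commute)
  have front: "x \<in> {a, b}" if x: "x \<in> frontier \<Omega>" "x \<in> sphere ?p r" for x
  proof -
    obtain t where "s \<le> t" "t < s + L" "x = \<gamma> t" by (rule frontier_param[OF x(1)])
    then show ?thesis using bspec[OF t(8), of t] x(2) by (auto simp: a_def b_def)
  qed
  have coords: "0 < V \<bullet> (?p + r *\<^sub>R left_normal ?w - a)" "V \<bullet> (?p - r *\<^sub>R left_normal ?w - a) < 0"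
  proof -
    \<comment> \<open>Coordinates of the ends of the chord relative to the centre, in the frame of v s.\<close>
    let ?x1 = "?w \<bullet> (a - ?p)" and ?y1 = "left_normal ?w \<bullet> (a - ?p)"
      and ?x2 = "?w \<bullet> (b - ?p)" and ?y2 = "left_normal ?w \<bullet> (b - ?p)"
    have sq: "?x1\<^sup>2 + ?y1\<^sup>2 = r\<^sup>2" "?x2\<^sup>2 + ?y2\<^sup>2 = r\<^sup>2"
      using norm_expansion[OF unit(2)[of s], of "a - ?p"] norm_expansion[OF unit(2)[of s], of "b - ?p"] ab
      by (auto simp: dist_norm norm_minus_commute)
    have x: "0 < ?x1" "?x2 < 0" using pos by auto
    then have "0 < ?x1\<^sup>2" "0 < ?x2\<^sup>2" by (auto simp: zero_less_power2)
    then have "?y1\<^sup>2 < r\<^sup>2" "?y2\<^sup>2 < r\<^sup>2" using sq by linarith+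
    then have y: "\<bar>?y1\<bar> < r" "\<bar>?y2\<bar> < r"
      using power2_less_imp_less[of "\<bar>?y1\<bar>" r] power2_less_imp_less[of "\<bar>?y2\<bar>" r] r_pos by simp_all
    have d: "a - b = (?x1 - ?x2) *\<^sub>R ?w + (?y1 - ?y2) *\<^sub>R left_normal ?w"
      using orthonormal_expansion[OF unit(2)[of s], of "a - b"] by (simp add: inner_diff_right)
    have JV: "V = (?x1 - ?x2) *\<^sub>R left_normal ?w - (?y1 - ?y2) *\<^sub>R ?w"
      unfolding V_def by (subst d) simp
    have ww: "?w \<bullet> ?w = 1" using unit by (simp add: norm_eq_1)
    have Va: "V \<bullet> (a - ?p) = (?x1 - ?x2) * ?y1 - (?y1 - ?y2) * ?x1"
      by (subst JV) (simp only: inner_diff_left inner_scaleR_left)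
    have VJ: "V \<bullet> left_normal ?w = ?x1 - ?x2"
      by (subst JV) (simp add: inner_diff_left ww)
    have "V \<bullet> (?p + r *\<^sub>R left_normal ?w - a) = r * (V \<bullet> left_normal ?w) - V \<bullet> (a - ?p)"
      by (simp add: inner_diff_right inner_add_right)
    also have "\<dots> = ?x1 * (r - ?y2) - ?x2 * (r - ?y1)" unfolding Va VJ by (simp add: algebra_simps)
    also have "\<dots> > 0" using x y by (smt (verit) mult_pos_pos mult_neg_pos)
    finally show "0 < V \<bullet> (?p + r *\<^sub>R left_normal ?w - a)" .
    have "V \<bullet> (?p - r *\<^sub>R left_normal ?w - a) = - r * (V \<bullet> left_normal ?w) - V \<bullet> (a - ?p)"
      by (simp add: inner_diff_right inner_add_right)
    also have "\<dots> = ?x2 * (r + ?y1) - ?x1 * (r + ?y2)" unfolding Va VJ by (simp add: algebra_simps)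
    also have "\<dots> < 0" using x y by (smt (verit) mult_pos_pos mult_neg_pos)
    finally show "V \<bullet> (?p - r *\<^sub>R left_normal ?w - a) < 0" .
  qed
  let ?U = "sphere ?p r \<inter> {x. e < n \<bullet> x}" and ?D = "sphere ?p r \<inter> {x. - e < - n \<bullet> x}"
  have conn: "connected ?U" "connected ?D"
    using circular_arc_connected[of n r ?p e] circular_arc_connected[of "- n" r ?p "- e"]
      \<open>norm n = 1\<close> r_pos by simp_all
  have disj: "?U \<inter> frontier \<Omega> = {}" "?D \<inter> frontier \<Omega> = {}"
    using front \<open>n \<bullet> b = e\<close> by (fastforce simp: e_def)+
  have nrm: "?p + r *\<^sub>R left_normal ?w \<in> sphere ?p r" "?p - r *\<^sub>R left_normal ?w \<in> sphere ?p r"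
    using r_pos unit(2)[of s] by (auto simp: dist_norm)
  show ?thesis
  proof (rule that[OF ab \<open>a \<noteq> b\<close> wab wab, unfolded V_def[symmetric]])
    fix x assume x: "x \<in> sphere ?p r" "0 < V \<bullet> (x - a)"
    have "?p + r *\<^sub>R left_normal ?w \<in> ?U" using nrm coords side by blast
    then have "?U \<subseteq> \<Omega>"
      using connected_Int_frontier[OF conn(1), of \<Omega>] disj normal_points_inside_outside(1)[of s] interior_subset by blast
    moreover have "x \<in> ?U" using x side(1)[of x] by simp
    ultimately have "x \<in> \<Omega>" "x \<notin> frontier \<Omega>" using disj(1) by blast+
    then show "x \<in> interior \<Omega>" using closed by (simp add: frontier_def closure_closed)
  next
    fix x assume x: "x \<in> sphere ?p r" "V \<bullet> (x - a) < 0"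
    have D: "y \<in> ?D \<longleftrightarrow> y \<in> sphere ?p r \<and> V \<bullet> (y - a) < 0" for y
      using side(2)[of y] by simp
    have "?p - r *\<^sub>R left_normal ?w \<in> ?D - \<Omega>"
      using nrm(2) coords(2) normal_points_inside_outside(2)[of s] unfolding D Diff_iff by blast
    moreover have "x \<in> ?D" unfolding D using x by blast
    ultimately show "x \<notin> \<Omega>"
      using connected_Int_frontier[OF conn(2), of \<Omega>] disj(2) by blast
  qed auto
qed

text \<open>
On the circle, away from the two ends of the chord, \<open>\<Omega>\<close> agrees locally with the half-plane
on the left of the chord. Here \<open>n\<close> is the unit normal of the chord and \<open>x r\<close> its signed distance
from the centre.
\<close>

lemma disk_area_derivatives:
  obtains n x where "norm n = 1" "\<bar>x\<bar> < 1"
    "0 < n \<bullet> left_normal (u s)" "0 < n \<bullet> left_normal (v s)"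
    "\<And>\<tau>. ((\<lambda>h. measure lebesgue (\<Omega> \<inter> cball (\<gamma> s + h *\<^sub>R \<tau>) r)) has_real_derivative
        2 * r * sqrt (1 - x\<^sup>2) * (n \<bullet> \<tau>)) (at 0)"
    "((\<lambda>h. measure lebesgue (\<Omega> \<inter> cball (\<gamma> s) (r + h))) has_real_derivative
        2 * r * (unit_cap_area x + x * sqrt (1 - x\<^sup>2))) (at 0)"
proof -
  obtain a b where ab: "a \<in> sphere (\<gamma> s) r" "b \<in> sphere (\<gamma> s) r" "a \<noteq> b"
    "0 < u s \<bullet> (a - b)" "0 < v s \<bullet> (a - b)"
    and inside: "\<And>x. x \<in> sphere (\<gamma> s) r \<Longrightarrow> 0 < left_normal (a - b) \<bullet> (x - a) \<Longrightarrow> x \<in> interior \<Omega>"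
    and outside: "\<And>x. x \<in> sphere (\<gamma> s) r \<Longrightarrow> left_normal (a - b) \<bullet> (x - a) < 0 \<Longrightarrow> x \<notin> \<Omega>"
    using chord_separates[of s] by blast
  define V where "V = left_normal (a - b)"
  have "0 < norm V" using \<open>a \<noteq> b\<close> by (simp add: V_def del: left_normal_linear_simps)
  define n where "n = V /\<^sub>R norm V"
  define e where "e = n \<bullet> a"
  have n: "norm n = 1" using \<open>0 < norm V\<close> by (simp add: n_def)
  have "V \<bullet> (a - b) = 0" unfolding V_def by (rule inner_left_normal(2))
  then have eb: "n \<bullet> b = e" by (simp add: e_def n_def inner_diff_right)
  have side: "e < n \<bullet> x \<longleftrightarrow> 0 < V \<bullet> (x - a)" "n \<bullet> x < e \<longleftrightarrow> V \<bullet> (x - a) < 0" for x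
    using \<open>0 < norm V\<close> by (simp_all add: e_def n_def inner_diff_right divide_inverse_commute)
  have nw: "0 < n \<bullet> left_normal w" if "0 < w \<bullet> (a - b)" for w
  proof -
    have "V \<bullet> left_normal w = w \<bullet> (a - b)"
      unfolding V_def by (simp only: inner_left_normal(1) inner_commute[of w])
    then show ?thesis using that \<open>0 < norm V\<close> by (simp add: n_def)
  qed
  have dist_chord: "\<bar>e - n \<bullet> \<gamma> s\<bar> < r"
  proof -
    let ?l = "\<lambda>y. left_normal n \<bullet> (y - \<gamma> s)"
    have sq: "(e - n \<bullet> \<gamma> s)\<^sup>2 + (?l y)\<^sup>2 = r\<^sup>2" if "y \<in> sphere (\<gamma> s) r" "n \<bullet> y = e" for y
      using norm_expansion[OF n, of "y - \<gamma> s"] that by (simp add: dist_norm norm_minus_commute inner_diff_right)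
    have "?l a \<noteq> 0 \<or> ?l b \<noteq> 0"
    proof (rule ccontr)
      assume "\<not> ?thesis"
      then have "left_normal n \<bullet> (a - b) = 0" "n \<bullet> (a - b) = 0"
        using eb by (auto simp: e_def inner_diff_right)
      then have "a - b = 0" using orthonormal_expansion[OF n, of "a - b"] by simp
      then show False using \<open>a \<noteq> b\<close> by simp
    qed
    then have "0 < (?l a)\<^sup>2 \<or> 0 < (?l b)\<^sup>2" by (simp add: zero_less_power2)
    then have "(e - n \<bullet> \<gamma> s)\<^sup>2 < r\<^sup>2"
      using sq[of a] sq[of b] ab(1,2) eb e_def by (smt (verit) zero_le_power2)
    then show ?thesis using power2_less_imp_less[of "\<bar>e - n \<bullet> \<gamma> s\<bar>" r] r_pos by simp
  qed
  define x where "x = (e - n \<bullet> \<gamma> s) / r"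
  have x1: "\<bar>x\<bar> < 1" using dist_chord r_pos by (simp add: x_def abs_divide)
  let ?H = "{x. e \<le> n \<bullet> x}"
  \<comment> \<open>On the open set U the region and the half-plane agree.\<close>
  define U where "U = (interior \<Omega> \<inter> {x. e < n \<bullet> x}) \<union> ((- \<Omega>) \<inter> {x. n \<bullet> x < e})"
  have "open U" unfolding U_def using closed
    by (intro open_Un open_Int open_interior open_Compl open_halfspace_gt open_halfspace_lt)
  have UH: "\<Omega> \<inter> U = ?H \<inter> U" using interior_subset[of \<Omega>] by (auto simp: U_def)
  have cover: "sphere (\<gamma> s) r - {a, b} \<subseteq> U"
  proof
    fix y assume y: "y \<in> sphere (\<gamma> s) r - {a, b}"
    then have "n \<bullet> y \<noteq> e" using chord_meets_circle[OF n ab(1,2), of y e] eb ab(3) by (auto simp: e_def)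
    then consider "e < n \<bullet> y" | "n \<bullet> y < e" by linarith
    then show "y \<in> U"
    proof cases
      case 1 then show ?thesis using inside[of y] side(1)[of y] y by (simp add: U_def V_def)
    next
      case 2 then show ?thesis using outside[of y] side(2)[of y] y by (simp add: U_def V_def)
    qed
  qed
  have deriv: "((\<lambda>h. measure lebesgue (\<Omega> \<inter> cball (\<gamma> s + h *\<^sub>R \<tau>) (r + h * \<eta>))) has_real_derivative
     2 * r * \<eta> * (unit_cap_area x + x * sqrt (1 - x\<^sup>2)) + 2 * r * sqrt (1 - x\<^sup>2) * (n \<bullet> \<tau>)) (at 0)" for \<tau> \<eta>
  proof (rule moving_disk_derivative_local[OF r_pos _ _ \<open>open U\<close> _ _ cover UH])
    show "\<Omega> \<in> sets lebesgue" using closed by (simp add: borel_closed sets_completionI_sets)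
    show "?H \<in> sets lebesgue" by (simp add: closed_halfspace_ge borel_closed sets_completionI_sets)
    show "{a, b} \<subseteq> sphere (\<gamma> s) r" using ab by simp
    show "((\<lambda>h. measure lebesgue (?H \<inter> cball (\<gamma> s + h *\<^sub>R \<tau>) (r + h * \<eta>))) has_real_derivative
     2 * r * \<eta> * (unit_cap_area x + x * sqrt (1 - x\<^sup>2)) + 2 * r * sqrt (1 - x\<^sup>2) * (n \<bullet> \<tau>)) (at 0)"
      unfolding x_def Int_commute[of ?H] by (rule cap_area_derivative[OF r_pos n dist_chord])
  qed simp
  show ?thesis
    by (rule that[OF n x1 nw[OF ab(4)] nw[OF ab(5)]]) (use deriv[of _ 0] deriv[of 0 1] in simp_all)
qed
end

section \<open>Polygons as graph-like curves\<close>

lemma polygonal_path_in_segments: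
  "\<exists>E. finite E \<and> path_image (polygonal_path vs) \<subseteq> (\<Union>(a, b)\<in>E. closed_segment a b)"
proof (induction vs rule: polygonal_path.induct)
  case 1 show ?case by (rule exI[of _ "{(0, 0)}"]) simp
next
  case (2 a) show ?case by (rule exI[of _ "{(a, a)}"]) simp
next
  case (3 a b) show ?case by (rule exI[of _ "{(a, b)}"]) simp
next
  case (4 a b c vs)
  then obtain E where "finite E" "path_image (polygonal_path (b # c # vs)) \<subseteq> (\<Union>(a, b)\<in>E. closed_segment a b)"
    by blast
  moreover have "path_image (polygonal_path (a # b # c # vs)) \<subseteq>
      closed_segment a b \<union> path_image (polygonal_path (b # c # vs))"
    using path_image_join_subset[of "linepath a b" "polygonal_path (b # c # vs)"] by simp
  ultimately show ?case by (intro exI[of _ "insert (a, b) E"]) auto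
qed

lemma tendsto_frequently_in_closed:
  assumes "(f \<longlongrightarrow> l) F" "\<exists>\<^sub>F x in F. f x \<in> C" "closed C"
  shows "l \<in> C"
proof (rule ccontr)
  assume "l \<notin> C"
  then have "\<forall>\<^sub>F x in F. f x \<in> - C" using assms by (intro topological_tendstoD) auto
  then show False using assms(2) by (simp add: frequently_def)
qed

text \<open>
Some segment contains \<open>\<gamma> (t + h)\<close> for arbitrarily small \<open>h\<close>; the limit of the difference
quotients over these \<open>h\<close> is parallel to it. The segments may overlap or cross.
\<close>

lemma velocity_in_segment_directions:
  fixes \<gamma> :: "real \<Rightarrow> 'a::euclidean_space"
  assumes "(\<gamma> has_vector_derivative d) (at t)" "norm d = 1"
    and "finite E" "\<And>t. \<gamma> t \<in> (\<Union>(a, b)\<in>E. closed_segment a b)"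
  shows "d \<in> (\<Union>(a, b)\<in>E. {sgn (b - a), - sgn (b - a)})"
proof -
  \<comment> \<open>Finitely many segments cover the curve, so one of them is met frequently.\<close>
  have "\<exists>e\<in>E. \<exists>\<^sub>F h in at 0. \<gamma> (t + h) \<in> closed_segment (fst e) (snd e)"
  proof (rule ccontr)
    assume "\<not> ?thesis"
    then have "\<forall>\<^sub>F h in at (0::real). \<forall>e\<in>E. \<gamma> (t + h) \<notin> closed_segment (fst e) (snd e)"
      using assms(3) by (intro eventually_ball_finite) (auto simp: frequently_def)
    then have "\<forall>\<^sub>F h in at (0::real). False"
      by (rule eventually_mono) (use assms(4) in fastforce)
    then show False by simp
  qed
  then obtain a b where ab: "(a, b) \<in> E" and freq: "\<exists>\<^sub>F h in at 0. \<gamma> (t + h) \<in> closed_segment a b"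
    by force
  have "isCont \<gamma> t" using assms(1) has_vector_derivative_continuous by blast
  then have "((\<lambda>h. \<gamma> (t + h)) \<longlongrightarrow> \<gamma> t) (at 0)" by (simp add: isCont_iff)
  then have "\<gamma> t \<in> closed_segment a b" using freq by (rule tendsto_frequently_in_closed) simp
  have diff: "x - y \<in> span {b - a}" if xy: "x \<in> closed_segment a b" "y \<in> closed_segment a b" for x y
  proof -
    obtain p q where pq: "x = (1 - p) *\<^sub>R a + p *\<^sub>R b" "y = (1 - q) *\<^sub>R a + q *\<^sub>R b"
      using xy by (auto simp: closed_segment_def)
    have "x - y = (p - q) *\<^sub>R (b - a)" unfolding pq by (simp add: algebra_simps)
    then show ?thesis by (simp add: span_scale span_base)
  qed
  have "((\<lambda>h. (\<gamma> (t + h) - \<gamma> t) /\<^sub>R h) \<longlongrightarrow> d) (at 0)"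
  proof -
    have "((\<lambda>h. norm (\<gamma> (t + h) - \<gamma> t - h *\<^sub>R d) / norm h) \<longlongrightarrow> 0) (at 0)"
      using assms(1) by (simp add: has_vector_derivative_def has_derivative_at)
    then have "((\<lambda>h. norm ((\<gamma> (t + h) - \<gamma> t) /\<^sub>R h - d)) \<longlongrightarrow> 0) (at 0)"
    proof (rule Lim_transform_eventually)
      have "norm (\<gamma> (t + h) - \<gamma> t - h *\<^sub>R d) / norm h = norm ((\<gamma> (t + h) - \<gamma> t) /\<^sub>R h - d)" if "h \<noteq> 0" for h
      proof -
        have "(\<gamma> (t + h) - \<gamma> t) /\<^sub>R h - d = (\<gamma> (t + h) - \<gamma> t - h *\<^sub>R d) /\<^sub>R h"
          using that by (simp add: scaleR_right_diff_distrib)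
        then show ?thesis by (simp add: divide_inverse_commute)
      qed
      then show "\<forall>\<^sub>F h in at 0. norm (\<gamma> (t + h) - \<gamma> t - h *\<^sub>R d) / norm h = norm ((\<gamma> (t + h) - \<gamma> t) /\<^sub>R h - d)"
        by (auto simp: eventually_at_filter)
    qed
    from tendsto_norm_zero_cancel[OF this] show ?thesis by (rule LIM_zero_cancel)
  qed
  moreover have "\<exists>\<^sub>F h in at 0. (\<gamma> (t + h) - \<gamma> t) /\<^sub>R h \<in> span {b - a}"
    using freq by (rule frequently_elim1) (intro span_scale diff \<open>\<gamma> t \<in> closed_segment a b\<close>)
  ultimately have "d \<in> span {b - a}" using closed_span by (rule tendsto_frequently_in_closed)
  then obtain k where k: "d = k *\<^sub>R (b - a)" by (auto simp: span_singleton)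
  then have "\<bar>k\<bar> * norm (b - a) = 1" using assms(2) by simp
  then have "inverse (norm (b - a)) = \<bar>k\<bar>" by (intro inverse_unique) (simp add: mult.commute)
  then have "k = inverse (norm (b - a)) \<or> k = - inverse (norm (b - a))" by linarith
  then have "d = sgn (b - a) \<or> d = - sgn (b - a)" by (auto simp: k sgn_div_norm)
  then show ?thesis using ab by auto
qed

lemma constant_velocity_affine:
  fixes \<gamma> :: "real \<Rightarrow> 'a::euclidean_space"
  assumes "a < b" "continuous_on {a..b} \<gamma>" "\<And>t. a < t \<Longrightarrow> t < b \<Longrightarrow> (\<gamma> has_vector_derivative d) (at t)"
    and "t \<in> {a..b}"
  shows "\<gamma> t = \<gamma> a + (t - a) *\<^sub>R d"
proof -
  have "\<gamma> t - t *\<^sub>R d = \<gamma> a - a *\<^sub>R d"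
  proof (rule has_derivative_zero_unique_strong_interval[of "{a, b}" a b "\<lambda>t. \<gamma> t - t *\<^sub>R d"])
    show "continuous_on {a..b} (\<lambda>t. \<gamma> t - t *\<^sub>R d)" using assms(2) by (intro continuous_intros)
    fix x assume "x \<in> {a..b} - {a, b}"
    then have "(\<gamma> has_vector_derivative d) (at x)" using assms(3)[of x] by auto
    moreover have "((\<lambda>t. t *\<^sub>R d) has_vector_derivative d) (at x)"
      by (auto intro!: derivative_eq_intros)
    ultimately have "((\<lambda>t. \<gamma> t - t *\<^sub>R d) has_vector_derivative d - d) (at x)"
      by (rule has_vector_derivative_diff)
    then show "((\<lambda>t. \<gamma> t - t *\<^sub>R d) has_derivative (\<lambda>h. 0)) (at x within {a..b})"
      by (simp add: has_vector_derivative_def has_derivative_at_withinI)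
  qed (use assms(4) in auto)
  then show ?thesis by (simp add: algebra_simps)
qed

text \<open>
Between exceptional parameters the velocity is continuous with values in a finite set, hence constant.
The parameterization hypothesis speaks of \<open>[0, L]\<close> only; periodicity carries the result to the right of
any parameter reduced to \<open>[0, L)\<close> and to the left of any parameter reduced to \<open>(0, L]\<close>.
\<close>

lemma polygon_one_sided_directions:
  fixes \<gamma> :: "real \<Rightarrow> real^2"
  assumes "polygon \<Omega>" "ccw_arclength_param \<gamma> L \<Omega>"
  obtains u v where "\<And>s. norm (u s) = 1" "\<And>s. norm (v s) = 1"
    "\<And>s. \<exists>\<epsilon>>0. \<forall>h\<in>{0..\<epsilon>}. \<gamma> (s + h) = \<gamma> s + h *\<^sub>R v s \<and> \<gamma> (s - h) = \<gamma> s - h *\<^sub>R u s"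
proof -
  have L: "0 < L" and cont: "continuous_on UNIV \<gamma>" and per: "\<And>s. \<gamma> (s + L) = \<gamma> s"
    and bij: "bij_betw \<gamma> {0..<L} (frontier \<Omega>)"
    and C1: "\<gamma> piecewise_C1_differentiable_on {0..L}"
    and unit: "\<And>s. \<gamma> differentiable (at s) \<Longrightarrow> norm (vector_derivative \<gamma> (at s)) = 1"
    using assms(2) unfolding ccw_arclength_param_def by auto
  obtain vs where "path_image (polygonal_path vs) = frontier \<Omega>" using assms(1) by (auto simp: polygon_def)
  then obtain E where E: "finite E" "frontier \<Omega> \<subseteq> (\<Union>(a, b)\<in>E. closed_segment a b)"
    using polygonal_path_in_segments[of vs] by auto
  have "\<gamma> t \<in> frontier \<Omega>" for t
  proof -
    obtain k :: int where "0 \<le> t + of_int k * L" "t + of_int k * L < 0 + L" by (rule reduce_to_period[OF L])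
    then have "\<gamma> (t + of_int k * L) \<in> frontier \<Omega>" using bij by (auto simp: bij_betw_def)
    then show ?thesis by (simp add: periodic_int_shift[where \<gamma> = \<gamma>, OF per])
  qed
  then have seg: "\<gamma> t \<in> (\<Union>(a, b)\<in>E. closed_segment a b)" for t using E(2) by blast
  obtain S D where S: "finite S" and D: "\<And>t. t \<in> {0..L} - S \<Longrightarrow> (\<gamma> has_vector_derivative D t) (at t)"
    and contD: "continuous_on ({0..L} - S) D"
    using C1 unfolding piecewise_C1_differentiable_on_def C1_differentiable_on_def by blast
  have normD: "norm (D t) = 1" if "t \<in> {0..L} - S" for t
    using unit[of t] D[OF that] by (auto simp: vector_derivative_at differentiableI_vector)
  have piece: "\<exists>d. norm d = 1 \<and> (\<forall>t\<in>{a..b}. \<gamma> t = \<gamma> a + (t - a) *\<^sub>R d)"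
    if ab: "0 \<le> a" "a < b" "b \<le> L" "{a<..<b} \<inter> S = {}" for a b
  proof -
    have sub: "{a<..<b} \<subseteq> {0..L} - S" using ab by auto
    have "D ` {a<..<b} \<subseteq> (\<Union>(a, b)\<in>E. {sgn (b - a), - sgn (b - a)})"
      using velocity_in_segment_directions[OF D normD E(1) seg] sub by blast
    then have "finite (D ` {a<..<b})" by (rule finite_subset) (use E(1) in auto)
    moreover have "connected (D ` {a<..<b})"
      using contD sub by (intro connected_continuous_image) (auto intro: continuous_on_subset)
    moreover have "D ` {a<..<b} \<noteq> {}" using ab by simp
    ultimately obtain d where d: "D ` {a<..<b} = {d}" by (metis connected_finite_iff_sing)
    have mid: "(a + b) / 2 \<in> {a<..<b}" using ab by simp
    have Dd: "D t = d" if "t \<in> {a<..<b}" for t using imageI[OF that, of D] d by simp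
    have "norm d = 1" using normD[OF subsetD[OF sub mid]] Dd[OF mid] by simp
    moreover have "\<gamma> t = \<gamma> a + (t - a) *\<^sub>R d" if "t \<in> {a..b}" for t
    proof (rule constant_velocity_affine[OF ab(2) _ _ that])
      show "continuous_on {a..b} \<gamma>" using cont by (rule continuous_on_subset) simp
      fix t assume "a < t" "t < b"
      then have t: "t \<in> {a<..<b}" by simp
      show "(\<gamma> has_vector_derivative d) (at t)" using D[OF subsetD[OF sub t]] Dd[OF t] by simp
    qed
    ultimately show ?thesis by blast
  qed
  have right: "\<exists>d. norm d = 1 \<and> (\<exists>\<epsilon>>0. \<forall>h\<in>{0..\<epsilon>}. \<gamma> (s + h) = \<gamma> s + h *\<^sub>R d)" for s
  proof -
    obtain k :: int where k: "0 \<le> s + of_int k * L" "s + of_int k * L < 0 + L" by (rule reduce_to_period[OF L])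
    define a where "a = s + of_int k * L"
    define b where "b = Min {x \<in> insert L S. a < x}"
    have fin: "finite {x \<in> insert L S. a < x}" "L \<in> {x \<in> insert L S. a < x}" using S k by (auto simp: a_def)
    then have "b \<in> {x \<in> insert L S. a < x}" unfolding b_def by (intro Min_in) auto
    moreover have "b \<le> x" if "x \<in> insert L S" "a < x" for x
      unfolding b_def using fin that by (intro Min_le) auto
    ultimately have "a < b" "b \<le> L" "{a<..<b} \<inter> S = {}" using fin(2) by force+
    note ab = this
    have "0 \<le> a" using k(1) by (simp add: a_def)
    obtain d where "norm d = 1" and aff: "\<forall>t\<in>{a..b}. \<gamma> t = \<gamma> a + (t - a) *\<^sub>R d"
      using piece[OF \<open>0 \<le> a\<close> \<open>a < b\<close> \<open>b \<le> L\<close>] ab by blast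
    note d = \<open>norm d = 1\<close> bspec[OF aff]
    have "\<gamma> (s + h) = \<gamma> s + h *\<^sub>R d" if "h \<in> {0..b - a}" for h
    proof -
      have "\<gamma> (s + h) = \<gamma> (a + h)"
        using periodic_int_shift[where \<gamma> = \<gamma>, OF per, of "s + h" k] by (simp add: a_def algebra_simps)
      also have "\<dots> = \<gamma> a + h *\<^sub>R d" using d(2)[of "a + h"] that by simp
      also have "\<gamma> a = \<gamma> s" unfolding a_def by (rule periodic_int_shift[where \<gamma> = \<gamma>, OF per])
      finally show ?thesis .
    qed
    moreover have "0 < b - a" using \<open>a < b\<close> by simp
    ultimately show ?thesis using d(1) by blast
  qed
  have left: "\<exists>d. norm d = 1 \<and> (\<exists>\<epsilon>>0. \<forall>h\<in>{0..\<epsilon>}. \<gamma> (s - h) = \<gamma> s - h *\<^sub>R d)" for s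
  proof -
    obtain k :: int where k: "- L \<le> - s + of_int k * L" "- s + of_int k * L < - L + L" by (rule reduce_to_period[OF L])
    define b where "b = s + of_int (- k) * L"
    have b: "0 < b" "b \<le> L" using k by (auto simp: b_def)
    define a where "a = Max {x \<in> insert 0 S. x < b}"
    have fin: "finite {x \<in> insert 0 S. x < b}" "0 \<in> {x \<in> insert 0 S. x < b}" using S b by auto
    then have "a \<in> {x \<in> insert 0 S. x < b}" unfolding a_def by (intro Max_in) auto
    moreover have "x \<le> a" if "x \<in> insert 0 S" "x < b" for x
      unfolding a_def using fin that by (intro Max_ge) auto
    ultimately have "a < b" "0 \<le> a" "{a<..<b} \<inter> S = {}" using fin(2) by force+
    note ab = this
    have "b \<le> L" by fact
    obtain d where "norm d = 1" and aff: "\<forall>t\<in>{a..b}. \<gamma> t = \<gamma> a + (t - a) *\<^sub>R d"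
      using piece[OF \<open>0 \<le> a\<close> \<open>a < b\<close> \<open>b \<le> L\<close>] ab by blast
    note d = \<open>norm d = 1\<close> bspec[OF aff]
    have "\<gamma> (s - h) = \<gamma> s - h *\<^sub>R d" if "h \<in> {0..b - a}" for h
    proof -
      have "\<gamma> (s - h) = \<gamma> (b - h)"
        using periodic_int_shift[where \<gamma> = \<gamma>, OF per, of "s - h" "- k"] by (simp add: b_def algebra_simps)
      also have "\<dots> = \<gamma> b - h *\<^sub>R d"
      proof -
        have "\<gamma> (b - h) = \<gamma> a + (b - h - a) *\<^sub>R d" using d(2)[of "b - h"] that by simp
        moreover have "\<gamma> b = \<gamma> a + (b - a) *\<^sub>R d" using d(2)[of b] \<open>a < b\<close> by simp
        ultimately show ?thesis by (simp only:) (simp add: algebra_simps)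
      qed
      also have "\<gamma> b = \<gamma> s" unfolding b_def by (rule periodic_int_shift[where \<gamma> = \<gamma>, OF per])
      finally show ?thesis .
    qed
    moreover have "0 < b - a" using \<open>a < b\<close> by simp
    ultimately show ?thesis using d(1) by blast
  qed
  define v where "v = (\<lambda>s. SOME d. norm d = 1 \<and> (\<exists>\<epsilon>>0. \<forall>h\<in>{0..\<epsilon>}. \<gamma> (s + h) = \<gamma> s + h *\<^sub>R d))"
  define u where "u = (\<lambda>s. SOME d. norm d = 1 \<and> (\<exists>\<epsilon>>0. \<forall>h\<in>{0..\<epsilon>}. \<gamma> (s - h) = \<gamma> s - h *\<^sub>R d))"
  have v: "norm (v s) = 1 \<and> (\<exists>\<epsilon>>0. \<forall>h\<in>{0..\<epsilon>}. \<gamma> (s + h) = \<gamma> s + h *\<^sub>R v s)" for s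
    unfolding v_def by (rule someI_ex[OF right])
  have u: "norm (u s) = 1 \<and> (\<exists>\<epsilon>>0. \<forall>h\<in>{0..\<epsilon>}. \<gamma> (s - h) = \<gamma> s - h *\<^sub>R u s)" for s
    unfolding u_def by (rule someI_ex[OF left])
  show ?thesis
  proof (rule that[OF conjunct1[OF u] conjunct1[OF v]])
    fix s
    obtain \<epsilon>1 where "0 < \<epsilon>1" "\<forall>h\<in>{0..\<epsilon>1}. \<gamma> (s + h) = \<gamma> s + h *\<^sub>R v s" using v[of s] by blast
    moreover obtain \<epsilon>2 where "0 < \<epsilon>2" "\<forall>h\<in>{0..\<epsilon>2}. \<gamma> (s - h) = \<gamma> s - h *\<^sub>R u s" using u[of s] by blast
    ultimately show "\<exists>\<epsilon>>0. \<forall>h\<in>{0..\<epsilon>}. \<gamma> (s + h) = \<gamma> s + h *\<^sub>R v s \<and> \<gamma> (s - h) = \<gamma> s - h *\<^sub>R u s"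
      by (intro exI[of _ "min \<epsilon>1 \<epsilon>2"]) auto
  qed
qed

lemma one_sided_velocity:
  fixes \<gamma> :: "real \<Rightarrow> real^2"
  assumes "0 < \<epsilon>" "\<forall>h\<in>{0..\<epsilon>}. \<gamma> (s + h) = \<gamma> s + h *\<^sub>R v \<and> \<gamma> (s - h) = \<gamma> s - h *\<^sub>R u"
  shows "0 < h \<Longrightarrow> h < \<epsilon> \<Longrightarrow> (\<gamma> has_vector_derivative v) (at (s + h))"
    and "0 < h \<Longrightarrow> h < \<epsilon> \<Longrightarrow> (\<gamma> has_vector_derivative u) (at (s - h))"
proof -
  have aff: "(\<gamma> has_vector_derivative w) (at t)" if "open T" "t \<in> T" "\<And>x. x \<in> T \<Longrightarrow> \<gamma> x = \<gamma> s + (x - s) *\<^sub>R w" for T t w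
  proof (rule has_vector_derivative_transform_within_open[OF _ that(1,2)])
    show "((\<lambda>x. \<gamma> s + (x - s) *\<^sub>R w) has_vector_derivative w) (at t)"
      by (auto intro!: derivative_eq_intros)
  qed (use that in simp)
  { assume "0 < h" "h < \<epsilon>"
    have eq: "\<gamma> x = \<gamma> s + (x - s) *\<^sub>R v" if "x \<in> {s<..<s + \<epsilon>}" for x
      using assms(2) that by (auto dest!: bspec[of _ _ "x - s"])
    show "(\<gamma> has_vector_derivative v) (at (s + h))"
      by (rule aff[of "{s<..<s + \<epsilon>}", OF _ _ eq]) (use \<open>0 < h\<close> \<open>h < \<epsilon>\<close> in auto) }
  { assume "0 < h" "h < \<epsilon>"
    have eq: "\<gamma> x = \<gamma> s + (x - s) *\<^sub>R u" if "x \<in> {s - \<epsilon><..<s}" for x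
      using assms(2) that by (auto dest!: bspec[of _ _ "s - x"] simp: algebra_simps)
    show "(\<gamma> has_vector_derivative u) (at (s - h))"
      by (rule aff[of "{s - \<epsilon><..<s}", OF _ _ eq]) (use \<open>0 < h\<close> \<open>h < \<epsilon>\<close> in auto) }
qed

lemma tcgl_polygon_graph_like:
  assumes "0 < r" "polygon \<Omega>" "ccw_arclength_param \<gamma> L \<Omega>" "tcgl \<Omega> \<gamma> r"
  obtains u v where "graph_like_curve \<Omega> \<gamma> u v L r"
proof -
  obtain u v where uv: "\<And>s. norm (u s) = 1" "\<And>s. norm (v s) = 1"
    "\<And>s. \<exists>\<epsilon>>0. \<forall>h\<in>{0..\<epsilon>}. \<gamma> (s + h) = \<gamma> s + h *\<^sub>R v s \<and> \<gamma> (s - h) = \<gamma> s - h *\<^sub>R u s"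
    using polygon_one_sided_directions[OF assms(2,3)] by blast
  have LimL: "Lim (at_left s) (\<lambda>t. vector_derivative \<gamma> (at t)) = u s" for s
  proof -
    obtain \<epsilon> where \<epsilon>: "0 < \<epsilon>" "\<forall>h\<in>{0..\<epsilon>}. \<gamma> (s + h) = \<gamma> s + h *\<^sub>R v s \<and> \<gamma> (s - h) = \<gamma> s - h *\<^sub>R u s"
      using uv(3) by blast
    have "vector_derivative \<gamma> (at t) = u s" if "s - \<epsilon> < t" "t < s" for t
      using one_sided_velocity(2)[OF \<epsilon>, of "s - t"] that by (simp add: vector_derivative_at)
    then have "\<forall>\<^sub>F t in at_left s. vector_derivative \<gamma> (at t) = u s"
      using \<epsilon>(1) by (intro eventually_at_leftI[of "s - \<epsilon>"]) auto
    then show ?thesis by (intro tendsto_Lim tendsto_eventually) auto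
  qed
  have LimR: "Lim (at_right s) (\<lambda>t. vector_derivative \<gamma> (at t)) = v s" for s
  proof -
    obtain \<epsilon> where \<epsilon>: "0 < \<epsilon>" "\<forall>h\<in>{0..\<epsilon>}. \<gamma> (s + h) = \<gamma> s + h *\<^sub>R v s \<and> \<gamma> (s - h) = \<gamma> s - h *\<^sub>R u s"
      using uv(3) by blast
    have "vector_derivative \<gamma> (at t) = v s" if "s < t" "t < s + \<epsilon>" for t
      using one_sided_velocity(1)[OF \<epsilon>, of "t - s"] that by (simp add: vector_derivative_at)
    then have "\<forall>\<^sub>F t in at_right s. vector_derivative \<gamma> (at t) = v s"
      using \<epsilon>(1) by (intro eventually_at_rightI[of s "s + \<epsilon>"]) auto
    then show ?thesis by (intro tendsto_Lim tendsto_eventually) auto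
  qed
  have "graph_like_curve \<Omega> \<gamma> u v L r"
  proof
    show "closed \<Omega>" using assms(2) by (simp add: polygon_def compact_imp_closed)
    show "0 < r" by fact
    show "0 < L" "continuous_on UNIV \<gamma>" "bij_betw \<gamma> {0..<L} (frontier \<Omega>)" "\<gamma> (s + L) = \<gamma> s" for s
      using assms(3) by (auto simp: ccw_arclength_param_def)
    show "norm (u s) = 1" "norm (v s) = 1"
      "\<exists>\<epsilon>>0. \<forall>h\<in>{0..\<epsilon>}. \<gamma> (s + h) = \<gamma> s + h *\<^sub>R v s \<and> \<gamma> (s - h) = \<gamma> s - h *\<^sub>R u s" for s
      by (rule uv)+
    show "(\<alpha> *\<^sub>R u s + \<beta> *\<^sub>R v s) \<bullet> (x - y) \<noteq> 0"
      if "0 \<le> \<alpha>" "0 \<le> \<beta>" "0 < \<alpha> + \<beta>" "x \<in> frontier \<Omega>" "y \<in> frontier \<Omega>"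
       "x \<in> cball (\<gamma> s) r" "y \<in> cball (\<gamma> s) r" "x \<noteq> y" for \<alpha> \<beta> x y s
    proof -
      have "\<alpha> *\<^sub>R u s + \<beta> *\<^sub>R v s \<in> tangent_cone \<gamma> s"
        unfolding tangent_cone_def LimL LimR using that by blast
      then show ?thesis using assms(4) that unfolding tcgl_def tcgl_at_def by blast
    qed
    fix s
    obtain \<epsilon> where \<epsilon>: "0 < \<epsilon>" "\<forall>h\<in>{0..\<epsilon>}. \<gamma> (s + h) = \<gamma> s + h *\<^sub>R v s \<and> \<gamma> (s - h) = \<gamma> s - h *\<^sub>R u s"
      using uv(3) by blast
    have "\<forall>\<^sub>F \<delta> in at_right 0. \<gamma> (s + h) + \<delta> *\<^sub>R left_normal (v s) \<in> interior \<Omega>" if "0 < h" "h < \<epsilon>" for h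
    proof -
      have d: "(\<gamma> has_vector_derivative v s) (at (s + h))" using one_sided_velocity(1)[OF \<epsilon>] that by blast
      then have "\<gamma> differentiable (at (s + h))" by (rule differentiableI_vector)
      then show ?thesis
        using assms(3) vector_derivative_at[OF d] unfolding ccw_arclength_param_def by metis
    qed
    then show "\<exists>\<epsilon>>0. \<forall>h. 0 < h \<and> h < \<epsilon> \<longrightarrow>
       (\<forall>\<^sub>F \<delta> in at_right 0. \<gamma> (s + h) + \<delta> *\<^sub>R left_normal (v s) \<in> interior \<Omega>)"
      using \<epsilon>(1) by blast
  qed
  then show ?thesis by (rule that)
qed

section \<open>Equal area data give equal turns\<close>

context graph_like_curve begin

lemma directions_locally_constant:
  "\<exists>\<epsilon>>0. \<forall>h. 0 < h \<and> h < \<epsilon> \<longrightarrow> v (s + h) = v s \<and> v (s - h) = u s"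
proof -
  obtain \<epsilon> where \<epsilon>: "0 < \<epsilon>" "\<forall>h\<in>{0..\<epsilon>}. \<gamma> (s + h) = \<gamma> s + h *\<^sub>R v s \<and> \<gamma> (s - h) = \<gamma> s - h *\<^sub>R u s"
    using straight[of s] by blast
  have det: "v t = d" if "0 < \<delta>" "\<And>k. 0 \<le> k \<Longrightarrow> k \<le> \<delta> \<Longrightarrow> \<gamma> (t + k) = \<gamma> t + k *\<^sub>R d" for t \<delta> d
  proof -
    obtain \<epsilon>' where \<epsilon>': "0 < \<epsilon>'" "\<forall>h\<in>{0..\<epsilon>'}. \<gamma> (t + h) = \<gamma> t + h *\<^sub>R v t \<and> \<gamma> (t - h) = \<gamma> t - h *\<^sub>R u t"
      using straight[of t] by blast
    define k where "k = min \<delta> \<epsilon>'"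
    have k: "0 < k" "k \<le> \<delta>" "k \<le> \<epsilon>'" using \<open>0 < \<delta>\<close> \<epsilon>'(1) by (simp_all add: k_def)
    have "\<gamma> t + k *\<^sub>R v t = \<gamma> t + k *\<^sub>R d" using that(2)[of k] \<epsilon>'(2) k by force
    then show ?thesis using k(1) by simp
  qed
  have "v (s + h) = v s \<and> v (s - h) = u s" if h: "0 < h" "h < \<epsilon>" for h
  proof
    show "v (s + h) = v s"
    proof (rule det[of "\<epsilon> - h"])
      fix k assume "0 \<le> k" "k \<le> \<epsilon> - h"
      then have "\<gamma> (s + (h + k)) = \<gamma> s + (h + k) *\<^sub>R v s" "\<gamma> (s + h) = \<gamma> s + h *\<^sub>R v s"
        using \<epsilon>(2) h by auto
      then show "\<gamma> (s + h + k) = \<gamma> (s + h) + k *\<^sub>R v s" by (simp add: algebra_simps)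
    qed (use h in simp)
    show "v (s - h) = u s"
    proof (rule det[of h])
      fix k assume k: "0 \<le> k" "k \<le> h"
      then have "\<gamma> (s - (h - k)) = \<gamma> s - (h - k) *\<^sub>R u s" "\<gamma> (s - h) = \<gamma> s - h *\<^sub>R u s"
        using \<epsilon>(2) h by auto
      moreover have "s - h + k = s - (h - k)" by simp
      ultimately show "\<gamma> (s - h + k) = \<gamma> (s - h) + k *\<^sub>R u s" by (simp only:) (simp add: algebra_simps)
    qed (use h in simp)
  qed
  then show ?thesis using \<epsilon>(1) by blast
qed

end

text \<open>
If \<open>w1\<close> and \<open>w2\<close> have the same coordinates in the frames of \<open>n1\<close> and \<open>n2\<close>, then the
rotation that takes \<open>n1\<close> to \<open>n2\<close> takes \<open>w1\<close> to \<open>w2\<close>. The two inner products are the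
cosine and the sine of that rotation.
\<close>

lemma turn_between_frames:
  fixes n1 n2 w1 w2 :: "real^2"
  assumes "norm n1 = 1" "norm n2 = 1" "norm w1 = 1"
    and "n1 \<bullet> w1 = n2 \<bullet> w2" "n1 \<bullet> left_normal w1 = n2 \<bullet> left_normal w2"
  shows "w1 \<bullet> w2 = n1 \<bullet> n2" "left_normal w1 \<bullet> w2 = left_normal n1 \<bullet> n2"
proof -
  define \<alpha> where "\<alpha> = n1 \<bullet> w1"
  define \<beta> where "\<beta> = n1 \<bullet> left_normal w1"
  have w: "w1 = \<alpha> *\<^sub>R n1 - \<beta> *\<^sub>R left_normal n1" "w2 = \<alpha> *\<^sub>R n2 - \<beta> *\<^sub>R left_normal n2"
    using orthonormal_expansion[OF assms(1), of w1] orthonormal_expansion[OF assms(2), of w2] assms(4,5)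
      left_normal_skew[of n1 w1] left_normal_skew[of n2 w2] by (simp_all add: \<alpha>_def \<beta>_def)
  have "\<alpha>\<^sup>2 + \<beta>\<^sup>2 = 1"
    using norm_expansion[OF assms(1), of w1] assms(3) left_normal_skew[of n1 w1]
    by (simp add: \<alpha>_def \<beta>_def)
  then have one: "\<alpha> * \<alpha> + \<beta> * \<beta> = 1" by (simp add: power2_eq_square)
  have skew: "n1 \<bullet> left_normal n2 = - (left_normal n1 \<bullet> n2)" by (rule left_normal_skew)
  have "w1 \<bullet> w2 = (\<alpha> * \<alpha> + \<beta> * \<beta>) * (n1 \<bullet> n2)"
    unfolding w by (simp add: inner_diff_left inner_diff_right skew algebra_simps)
  then show "w1 \<bullet> w2 = n1 \<bullet> n2" using one by simp
  have "left_normal w1 \<bullet> w2 = (\<alpha> * \<alpha> + \<beta> * \<beta>) * (left_normal n1 \<bullet> n2)"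
    unfolding w by (simp add: inner_diff_left inner_diff_right inner_add_left skew algebra_simps)
  then show "left_normal w1 \<bullet> w2 = left_normal n1 \<bullet> n2" using one by simp
qed

lemma derivative_determined_on_right:
  fixes F G :: "real \<Rightarrow> real"
  assumes "(F has_real_derivative a) (at 0)" "(G has_real_derivative b) (at 0)"
    and "0 < \<epsilon>" "\<And>h. 0 \<le> h \<Longrightarrow> h \<le> \<epsilon> \<Longrightarrow> F h = G h"
  shows "a = b"
proof -
  have d: "((\<lambda>h. F h - G h) has_real_derivative a - b) (at 0)" by (rule DERIV_diff[OF assms(1,2)])
  have zero: "F h - G h = 0" if "0 \<le> h" "h \<le> \<epsilon>" for h using assms(4)[OF that] by simp
  have "\<not> 0 < a - b"
  proof
    assume "0 < a - b"
    from DERIV_pos_inc_right[OF d this] obtain \<delta> where \<delta>: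
      "\<And>h. 0 < h \<Longrightarrow> h < \<delta> \<Longrightarrow> F 0 - G 0 < F (0 + h) - G (0 + h)" and "0 < \<delta>" by blast
    have "0 < min \<epsilon> \<delta>" using \<open>0 < \<epsilon>\<close> \<open>0 < \<delta>\<close> by simp
    then obtain h where "0 < h" "h < min \<epsilon> \<delta>" by (rule dense[THEN exE]) blast
    then show False using \<delta>[of h] zero[of 0] zero[of h] \<open>0 < \<epsilon>\<close> by simp
  qed
  moreover have "\<not> a - b < 0"
  proof
    assume "a - b < 0"
    from DERIV_neg_dec_right[OF d this] obtain \<delta> where \<delta>:
      "\<And>h. 0 < h \<Longrightarrow> h < \<delta> \<Longrightarrow> F (0 + h) - G (0 + h) < F 0 - G 0" and "0 < \<delta>" by blast
    have "0 < min \<epsilon> \<delta>" using \<open>0 < \<epsilon>\<close> \<open>0 < \<delta>\<close> by simp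
    then obtain h where "0 < h" "h < min \<epsilon> \<delta>" by (rule dense[THEN exE]) blast
    then show False using \<delta>[of h] zero[of 0] zero[of h] \<open>0 < \<epsilon>\<close> by simp
  qed
  ultimately show ?thesis by simp
qed

text \<open>
The two inner products are the cosine and the sine of the rotation between corresponding directions; both
pairs of directions give the rotation between the chord normals.
\<close>

lemma same_area_data_same_turn:
  assumes "graph_like_curve \<Omega>1 \<gamma>1 u1 v1 L r" "graph_like_curve \<Omega>2 \<gamma>2 u2 v2 L r"
    and area: "\<And>t. area_invariant \<Omega>1 \<gamma>1 t r = area_invariant \<Omega>2 \<gamma>2 t r"
    and radius: "same_derivative_at (\<lambda>\<rho>. area_invariant \<Omega>1 \<gamma>1 s \<rho>) (\<lambda>\<rho>. area_invariant \<Omega>2 \<gamma>2 s \<rho>) r"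
  shows "u1 s \<bullet> u2 s = v1 s \<bullet> v2 s" "left_normal (u1 s) \<bullet> u2 s = left_normal (v1 s) \<bullet> v2 s"
proof -
  interpret A: graph_like_curve \<Omega>1 \<gamma>1 u1 v1 L r by fact
  interpret B: graph_like_curve \<Omega>2 \<gamma>2 u2 v2 L r by fact
  obtain n1 x1 where n1: "norm n1 = 1" and x1: "\<bar>x1\<bar> < 1"
    and up1: "0 < n1 \<bullet> left_normal (u1 s)" "0 < n1 \<bullet> left_normal (v1 s)"
    and move1: "\<And>\<tau>. ((\<lambda>h. measure lebesgue (\<Omega>1 \<inter> cball (\<gamma>1 s + h *\<^sub>R \<tau>) r)) has_real_derivative
        2 * r * sqrt (1 - x1\<^sup>2) * (n1 \<bullet> \<tau>)) (at 0)"
    and grow1: "((\<lambda>h. measure lebesgue (\<Omega>1 \<inter> cball (\<gamma>1 s) (r + h))) has_real_derivative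
        2 * r * (unit_cap_area x1 + x1 * sqrt (1 - x1\<^sup>2))) (at 0)"
    by (rule A.disk_area_derivatives[of s]) blast
  obtain n2 x2 where n2: "norm n2 = 1" and x2: "\<bar>x2\<bar> < 1"
    and up2: "0 < n2 \<bullet> left_normal (u2 s)" "0 < n2 \<bullet> left_normal (v2 s)"
    and move2: "\<And>\<tau>. ((\<lambda>h. measure lebesgue (\<Omega>2 \<inter> cball (\<gamma>2 s + h *\<^sub>R \<tau>) r)) has_real_derivative
        2 * r * sqrt (1 - x2\<^sup>2) * (n2 \<bullet> \<tau>)) (at 0)"
    and grow2: "((\<lambda>h. measure lebesgue (\<Omega>2 \<inter> cball (\<gamma>2 s) (r + h))) has_real_derivative
        2 * r * (unit_cap_area x2 + x2 * sqrt (1 - x2\<^sup>2))) (at 0)"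
    by (rule B.disk_area_derivatives[of s]) blast
  have at_r: "((\<lambda>\<rho>. area_invariant \<Omega> \<gamma> s \<rho>) has_real_derivative D) (at r)"
    if "((\<lambda>h. measure lebesgue (\<Omega> \<inter> cball (\<gamma> s) (r + h))) has_real_derivative D) (at 0)" for \<Omega> \<gamma> D
    using that DERIV_shift[of "\<lambda>\<rho>. area_invariant \<Omega> \<gamma> s \<rho>" D 0 r] by (simp add: area_invariant_def add.commute)
  have "2 * r * (unit_cap_area x1 + x1 * sqrt (1 - x1\<^sup>2)) = 2 * r * (unit_cap_area x2 + x2 * sqrt (1 - x2\<^sup>2))"
    using at_r[where \<Omega> = \<Omega>1 and \<gamma> = \<gamma>1, OF grow1] at_r[where \<Omega> = \<Omega>2 and \<gamma> = \<gamma>2, OF grow2] radius unfolding same_derivative_at_def by (metis DERIV_unique)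
  then have "unit_cap_area x1 + x1 * sqrt (1 - x1\<^sup>2) = unit_cap_area x2 + x2 * sqrt (1 - x2\<^sup>2)"
    using A.r_pos by simp
  then have "x1 = x2" using unit_cap_combination_inj[of x1 x2] x1 x2 by (simp add: abs_less_iff)
  define c where "c = 2 * r * sqrt (1 - x1\<^sup>2)"
  have "x1\<^sup>2 < 1" using x1 by (simp add: abs_square_less_1)
  then have "0 < c" using A.r_pos by (simp add: c_def)
  obtain \<epsilon>1 where \<epsilon>1: "0 < \<epsilon>1" "\<forall>h\<in>{0..\<epsilon>1}. \<gamma>1 (s + h) = \<gamma>1 s + h *\<^sub>R v1 s \<and> \<gamma>1 (s - h) = \<gamma>1 s - h *\<^sub>R u1 s"
    using A.straight[of s] by blast
  obtain \<epsilon>2 where \<epsilon>2: "0 < \<epsilon>2" "\<forall>h\<in>{0..\<epsilon>2}. \<gamma>2 (s + h) = \<gamma>2 s + h *\<^sub>R v2 s \<and> \<gamma>2 (s - h) = \<gamma>2 s - h *\<^sub>R u2 s"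
    using B.straight[of s] by blast
  define \<epsilon> where "\<epsilon> = min \<epsilon>1 \<epsilon>2"
  have "0 < \<epsilon>" using \<epsilon>1(1) \<epsilon>2(1) by (simp add: \<epsilon>_def)
  have "c * (n1 \<bullet> v1 s) = c * (n2 \<bullet> v2 s)"
    unfolding c_def
  proof (rule derivative_determined_on_right[OF move1[of "v1 s"] move2[of "v2 s", folded \<open>x1 = x2\<close>] \<open>0 < \<epsilon>\<close>])
    fix h assume "0 \<le> h" "h \<le> \<epsilon>"
    then have "\<gamma>1 (s + h) = \<gamma>1 s + h *\<^sub>R v1 s" "\<gamma>2 (s + h) = \<gamma>2 s + h *\<^sub>R v2 s"
      using \<epsilon>1(2) \<epsilon>2(2) by (auto simp: \<epsilon>_def)
    then show "measure lebesgue (\<Omega>1 \<inter> cball (\<gamma>1 s + h *\<^sub>R v1 s) r) = measure lebesgue (\<Omega>2 \<inter> cball (\<gamma>2 s + h *\<^sub>R v2 s) r)"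
      using area[of "s + h"] unfolding area_invariant_def by metis
  qed
  then have nv: "n1 \<bullet> v1 s = n2 \<bullet> v2 s" using \<open>0 < c\<close> by simp
  have "c * (n1 \<bullet> (- u1 s)) = c * (n2 \<bullet> (- u2 s))"
    unfolding c_def
  proof (rule derivative_determined_on_right[OF move1[of "- u1 s"] move2[of "- u2 s", folded \<open>x1 = x2\<close>] \<open>0 < \<epsilon>\<close>])
    fix h assume "0 \<le> h" "h \<le> \<epsilon>"
    then have "\<gamma>1 (s - h) = \<gamma>1 s + h *\<^sub>R (- u1 s)" "\<gamma>2 (s - h) = \<gamma>2 s + h *\<^sub>R (- u2 s)"
      using \<epsilon>1(2) \<epsilon>2(2) by (auto simp: \<epsilon>_def)
    then show "measure lebesgue (\<Omega>1 \<inter> cball (\<gamma>1 s + h *\<^sub>R (- u1 s)) r) = measure lebesgue (\<Omega>2 \<inter> cball (\<gamma>2 s + h *\<^sub>R (- u2 s)) r)"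
      using area[of "s - h"] unfolding area_invariant_def by metis
  qed
  then have nu: "n1 \<bullet> u1 s = n2 \<bullet> u2 s" using \<open>0 < c\<close> by simp
  have normal: "n1 \<bullet> left_normal w1 = n2 \<bullet> left_normal w2"
    if "norm w1 = 1" "norm w2 = 1" "n1 \<bullet> w1 = n2 \<bullet> w2" "0 < n1 \<bullet> left_normal w1" "0 < n2 \<bullet> left_normal w2" for w1 w2
  proof -
    have "(n1 \<bullet> left_normal w1)\<^sup>2 = (n2 \<bullet> left_normal w2)\<^sup>2"
      using norm_expansion[OF that(1), of n1] norm_expansion[OF that(2), of n2] n1 n2 that(3)
      by (simp add: inner_commute)
    then show ?thesis using that(4,5) by (simp add: power2_eq_iff_nonneg)
  qed
  note V = turn_between_frames[OF n1 n2 A.unit(2) nv normal[OF A.unit(2) B.unit(2) nv up1(2) up2(2)]]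
  note U = turn_between_frames[OF n1 n2 A.unit(1) nu normal[OF A.unit(1) B.unit(1) nu up1(1) up2(1)]]
  show "u1 s \<bullet> u2 s = v1 s \<bullet> v2 s" "left_normal (u1 s) \<bullet> u2 s = left_normal (v1 s) \<bullet> v2 s"
    using U V by simp_all
qed

section \<open>Congruence of the curves and of the regions\<close>

lemma constant_if_locally_constant:
  fixes f :: "real \<Rightarrow> 'a"
  assumes "\<And>s. \<exists>\<epsilon>>0. \<forall>h. 0 < h \<and> h < \<epsilon> \<longrightarrow> f (s + h) = f s \<and> f (s - h) = f s"
  shows "f s = f t"
proof (rule connected_local_const[of UNIV])
  show "\<forall>a\<in>UNIV. \<forall>\<^sub>F b in at a within UNIV. f a = f b"
  proof
    fix a :: real
    obtain \<epsilon> where "0 < \<epsilon>" and \<epsilon>: "\<And>h. 0 < h \<Longrightarrow> h < \<epsilon> \<Longrightarrow> f (a + h) = f a \<and> f (a - h) = f a"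
      using assms[of a] by blast
    have "f a = f b" if "b \<noteq> a" "dist b a < \<epsilon>" for b
      using \<epsilon>[of "b - a"] \<epsilon>[of "a - b"] that by (cases "a < b") (auto simp: dist_real_def)
    then show "\<forall>\<^sub>F b in at a within UNIV. f a = f b"
      unfolding eventually_at using \<open>0 < \<epsilon>\<close> by blast
  qed
qed auto

text \<open>
The rotation between corresponding directions is the same on both sides of each parameter, hence one
rotation serves for all. After it, the two curves have the same directions everywhere and differ by a
translation.
\<close>

lemma same_turns_congruent_curves:
  assumes A: "graph_like_curve \<Omega>1 \<gamma>1 u1 v1 L r" and B: "graph_like_curve \<Omega>2 \<gamma>2 u2 v2 L r"
    and turn: "\<And>s. u1 s \<bullet> u2 s = v1 s \<bullet> v2 s" "\<And>s. left_normal (u1 s) \<bullet> u2 s = left_normal (v1 s) \<bullet> v2 s"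
  obtains c d a where "c\<^sup>2 + d\<^sup>2 = 1" "\<And>s. \<gamma>2 s = c *\<^sub>R \<gamma>1 s + d *\<^sub>R left_normal (\<gamma>1 s) + a"
proof -
  interpret A: graph_like_curve \<Omega>1 \<gamma>1 u1 v1 L r by fact
  interpret B: graph_like_curve \<Omega>2 \<gamma>2 u2 v2 L r by fact
  have "(v1 s \<bullet> v2 s, left_normal (v1 s) \<bullet> v2 s) = (v1 0 \<bullet> v2 0, left_normal (v1 0) \<bullet> v2 0)" for s
  proof (rule constant_if_locally_constant)
    fix s
    obtain \<epsilon>1 where "0 < \<epsilon>1" "\<forall>h. 0 < h \<and> h < \<epsilon>1 \<longrightarrow> v1 (s + h) = v1 s \<and> v1 (s - h) = u1 s"
      using A.directions_locally_constant by blast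
    moreover obtain \<epsilon>2 where "0 < \<epsilon>2" "\<forall>h. 0 < h \<and> h < \<epsilon>2 \<longrightarrow> v2 (s + h) = v2 s \<and> v2 (s - h) = u2 s"
      using B.directions_locally_constant by blast
    ultimately show "\<exists>\<epsilon>>0. \<forall>h. 0 < h \<and> h < \<epsilon> \<longrightarrow>
      (v1 (s + h) \<bullet> v2 (s + h), left_normal (v1 (s + h)) \<bullet> v2 (s + h)) = (v1 s \<bullet> v2 s, left_normal (v1 s) \<bullet> v2 s) \<and>
      (v1 (s - h) \<bullet> v2 (s - h), left_normal (v1 (s - h)) \<bullet> v2 (s - h)) = (v1 s \<bullet> v2 s, left_normal (v1 s) \<bullet> v2 s)"
      using turn[of s] by (intro exI[of _ "min \<epsilon>1 \<epsilon>2"]) simp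
  qed
  moreover define c where "c = v1 0 \<bullet> v2 0"
  moreover define d where "d = left_normal (v1 0) \<bullet> v2 0"
  ultimately have cd: "v1 s \<bullet> v2 s = c" "left_normal (v1 s) \<bullet> v2 s = d" for s by auto
  have v2: "v2 s = c *\<^sub>R v1 s + d *\<^sub>R left_normal (v1 s)" for s
    using orthonormal_expansion[OF A.unit(2)[of s], of "v2 s"] by (simp add: cd)
  have u2: "u2 s = c *\<^sub>R u1 s + d *\<^sub>R left_normal (u1 s)" for s
    using orthonormal_expansion[OF A.unit(1)[of s], of "u2 s"] by (simp add: turn cd)
  have one: "c\<^sup>2 + d\<^sup>2 = 1"
    using norm_expansion[OF A.unit(2)[of 0], of "v2 0"] B.unit(2)[of 0] by (simp add: c_def d_def)
  define f where "f = (\<lambda>s. \<gamma>2 s - (c *\<^sub>R \<gamma>1 s + d *\<^sub>R left_normal (\<gamma>1 s)))"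
  have "f s = f 0" for s
  proof (rule constant_if_locally_constant)
    fix s
    obtain \<epsilon>1 where \<epsilon>1: "0 < \<epsilon>1" "\<forall>h\<in>{0..\<epsilon>1}. \<gamma>1 (s + h) = \<gamma>1 s + h *\<^sub>R v1 s \<and> \<gamma>1 (s - h) = \<gamma>1 s - h *\<^sub>R u1 s"
      using A.straight[of s] by blast
    obtain \<epsilon>2 where \<epsilon>2: "0 < \<epsilon>2" "\<forall>h\<in>{0..\<epsilon>2}. \<gamma>2 (s + h) = \<gamma>2 s + h *\<^sub>R v2 s \<and> \<gamma>2 (s - h) = \<gamma>2 s - h *\<^sub>R u2 s"
      using B.straight[of s] by blast
    have "f (s + h) = f s \<and> f (s - h) = f s" if "0 < h" "h < min \<epsilon>1 \<epsilon>2" for h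
    proof -
      have g1: "\<gamma>1 (s + h) = \<gamma>1 s + h *\<^sub>R v1 s" "\<gamma>1 (s - h) = \<gamma>1 s - h *\<^sub>R u1 s"
        and g2: "\<gamma>2 (s + h) = \<gamma>2 s + h *\<^sub>R v2 s" "\<gamma>2 (s - h) = \<gamma>2 s - h *\<^sub>R u2 s"
        using \<epsilon>1(2) \<epsilon>2(2) that by auto
      show ?thesis unfolding f_def g1 g2 u2 v2 by (simp add: algebra_simps)
    qed
    then show "\<exists>\<epsilon>>0. \<forall>h. 0 < h \<and> h < \<epsilon> \<longrightarrow> f (s + h) = f s \<and> f (s - h) = f s"
      using \<epsilon>1(1) \<epsilon>2(1) by (intro exI[of _ "min \<epsilon>1 \<epsilon>2"]) simp
  qed
  then have "\<gamma>2 s = c *\<^sub>R \<gamma>1 s + d *\<^sub>R left_normal (\<gamma>1 s) + f 0" for s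
    by (metis f_def add.commute diff_add_cancel)
  then show ?thesis using that one by blast
qed

text \<open>
Inside and outside are connected and miss the frontier of \<open>K\<close>, so each lies in \<open>K\<close> or
misses it. The outside is unbounded, so it misses \<open>K\<close>; the interior of \<open>K\<close> is therefore inside.
\<close>

lemma jordan_region_eq:
  fixes K :: "complex set"
  assumes "compact K" "interior K \<noteq> {}" "simple_path c" "pathfinish c = pathstart c" "frontier K = path_image c"
  shows "K = path_image c \<union> inside (path_image c)"
proof -
  note J = Jordan_inside_outside[OF assms(3,4)]
  have split: "inside (path_image c) \<union> outside (path_image c) = - path_image c" using J by blast
  have KC: "K = frontier K \<union> interior K"
    using assms(1) frontier_subset_closed[of K] interior_subset[of K] by (auto simp: compact_imp_closed frontier_def)
  have out: "outside (path_image c) \<inter> K = {}"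
  proof (rule ccontr)
    assume "outside (path_image c) \<inter> K \<noteq> {}"
    moreover have "outside (path_image c) \<inter> frontier K = {}" using split assms(5) by blast
    ultimately have "outside (path_image c) \<subseteq> K" using connected_Int_frontier[of "outside (path_image c)" K] J by blast
    then show False using J assms(1) bounded_subset compact_imp_bounded by blast
  qed
  have "interior K \<inter> inside (path_image c) \<noteq> {}"
    using assms(2,5) out split interior_subset[of K] by (fastforce simp: frontier_def)
  then have "inside (path_image c) \<inter> K \<noteq> {}" using interior_subset by blast
  moreover have "inside (path_image c) \<inter> frontier K = {}" using split assms(5) by blast
  ultimately have "inside (path_image c) \<subseteq> K" using connected_Int_frontier[of "inside (path_image c)" K] J by blast
  moreover have "path_image c \<subseteq> K" using assms(1,5) frontier_subset_closed compact_imp_closed by blast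
  moreover have "K \<subseteq> path_image c \<union> inside (path_image c)" using out split by blast
  ultimately show ?thesis by blast
qed

lemma jordan_region_unique:
  fixes K K' :: "(real^2) set"
  assumes "compact K" "compact K'" "interior K \<noteq> {}" "interior K' \<noteq> {}"
    and "simple_path c" "pathfinish c = pathstart c" "frontier K = path_image c" "frontier K' = path_image c"
  shows "K = K'"
proof -
  \<comment> \<open>The Jordan curve theorem is stated for the complex plane.\<close>
  define \<phi> where "\<phi> = (\<lambda>x::real^2. Complex (x$1) (x$2))"
  have lin: "linear \<phi>" by (rule linearI) (auto simp: \<phi>_def complex_eq_iff)
  have "inj \<phi>" by (rule injI) (auto simp: \<phi>_def vec_eq_iff forall_2)
  moreover have "surj \<phi>"
  proof (rule surjI)
    show "\<phi> (vector [Re z, Im z]) = z" for z by (simp add: \<phi>_def)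
  qed
  ultimately have "bij \<phi>" by (simp add: bij_def)
  have region: "\<phi> ` X = path_image (\<phi> \<circ> c) \<union> inside (path_image (\<phi> \<circ> c))"
    if "compact X" "interior X \<noteq> {}" "frontier X = path_image c" for X
  proof (rule jordan_region_eq)
    show "compact (\<phi> ` X)" 
      using lin that(1) by (intro compact_continuous_image linear_continuous_on) (simp add: linear_conv_bounded_linear)
    have int: "interior (\<phi> ` X) = \<phi> ` interior X" by (rule interior_bijective_linear_image[OF lin \<open>bij \<phi>\<close>])
    then show "interior (\<phi> ` X) \<noteq> {}" using that(2) by simp
    show "simple_path (\<phi> \<circ> c)" using simple_path_linear_image_eq[OF lin \<open>inj \<phi>\<close>] assms(5) by blast
    show "pathfinish (\<phi> \<circ> c) = pathstart (\<phi> \<circ> c)" using assms(6) by (simp add: pathfinish_def pathstart_def)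
    have "closure (\<phi> ` X) = \<phi> ` closure X" by (rule closure_injective_linear_image[OF lin \<open>inj \<phi>\<close>, symmetric])
    then show "frontier (\<phi> ` X) = path_image (\<phi> \<circ> c)"
      unfolding frontier_def path_image_compose that(3)[unfolded frontier_def, symmetric] int
        image_set_diff[OF \<open>inj \<phi>\<close>] by simp
  qed
  have "\<phi> ` K = \<phi> ` K'" using region[OF assms(1,3,7)] region[OF assms(2,4,8)] by simp
  then show ?thesis using \<open>inj \<phi>\<close> by (simp add: inj_image_eq_iff)
qed

theorem theorem27:
  fixes \<Omega>1 \<Omega>2 :: "(real^2) set"
    and \<gamma>1 \<gamma>2 :: "real \<Rightarrow> real^2"
    and L r :: real
  assumes "0 < r"
    and "polygon \<Omega>1" and "polygon \<Omega>2"
    and "ccw_arclength_param \<gamma>1 L \<Omega>1" and "ccw_arclength_param \<gamma>2 L \<Omega>2"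
    and "tcgl \<Omega>1 \<gamma>1 r" and "tcgl \<Omega>2 \<gamma>2 r"
    and "\<And>s. s \<in> {0..<L} \<Longrightarrow> area_invariant \<Omega>1 \<gamma>1 s r = area_invariant \<Omega>2 \<gamma>2 s r"
    and "\<And>s. s \<in> {0..<L} \<Longrightarrow>
           same_derivative_at (\<lambda>\<rho>. area_invariant \<Omega>1 \<gamma>1 s \<rho>) (\<lambda>\<rho>. area_invariant \<Omega>2 \<gamma>2 s \<rho>) r"
    and "\<And>s. s \<in> {0..<L} \<Longrightarrow>
           same_derivative_at (\<lambda>\<sigma>. area_invariant \<Omega>1 \<gamma>1 \<sigma> r) (\<lambda>\<sigma>. area_invariant \<Omega>2 \<gamma>2 \<sigma> r) s"
  shows "\<exists>Q a. rotation_matrix Q \<and> \<Omega>2 = (\<lambda>x. Q *v x + a) ` \<Omega>1"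
proof -
  obtain u1 v1 where glc1: "graph_like_curve \<Omega>1 \<gamma>1 u1 v1 L r"
    by (rule tcgl_polygon_graph_like[OF assms(1,2,4,6)])
  obtain u2 v2 where glc2: "graph_like_curve \<Omega>2 \<gamma>2 u2 v2 L r"
    by (rule tcgl_polygon_graph_like[OF assms(1,3,5,7)])
  interpret A: graph_like_curve \<Omega>1 \<gamma>1 u1 v1 L r by fact
  interpret B: graph_like_curve \<Omega>2 \<gamma>2 u2 v2 L r by fact
  have per: "area_invariant \<Omega>1 \<gamma>1 (s + of_int k * L) = area_invariant \<Omega>1 \<gamma>1 s"
    "area_invariant \<Omega>2 \<gamma>2 (s + of_int k * L) = area_invariant \<Omega>2 \<gamma>2 s" for s k
    by (simp_all add: area_invariant_def fun_eq_iff A.periodic_int B.periodic_int)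
  have area: "area_invariant \<Omega>1 \<gamma>1 s r = area_invariant \<Omega>2 \<gamma>2 s r"
    and radius: "same_derivative_at (\<lambda>\<rho>. area_invariant \<Omega>1 \<gamma>1 s \<rho>) (\<lambda>\<rho>. area_invariant \<Omega>2 \<gamma>2 s \<rho>) r" for s
  proof -
    obtain k :: int where k: "0 \<le> s + of_int k * L" "s + of_int k * L < 0 + L" by (rule A.reduce_period)
    then have "s + of_int k * L \<in> {0..<L}" by simp
    from assms(8)[OF this] assms(9)[OF this]
    show "area_invariant \<Omega>1 \<gamma>1 s r = area_invariant \<Omega>2 \<gamma>2 s r"
     "same_derivative_at (\<lambda>\<rho>. area_invariant \<Omega>1 \<gamma>1 s \<rho>) (\<lambda>\<rho>. area_invariant \<Omega>2 \<gamma>2 s \<rho>) r"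
      unfolding per by blast+
  qed
  obtain c d a where cd: "c\<^sup>2 + d\<^sup>2 = 1"
    and \<gamma>2: "\<And>s. \<gamma>2 s = c *\<^sub>R \<gamma>1 s + d *\<^sub>R left_normal (\<gamma>1 s) + a"
    using same_turns_congruent_curves[OF glc1 glc2 same_area_data_same_turn[OF glc1 glc2 area radius]] by blast
  define Q :: "real^2^2" where "Q = vector [vector [c, - d], vector [d, c]]"
  have Qv: "Q *v x = c *\<^sub>R x + d *\<^sub>R left_normal x" for x
    by (simp add: Q_def plane_coords matrix_vector_mult_def)
  have "transpose Q ** Q = mat 1"
    using cd by (simp add: Q_def vec_eq_iff forall_2 matrix_matrix_mult_def transpose_def mat_def sum_2
        power2_eq_square algebra_simps)
  then have "orthogonal_matrix Q" by (simp add: orthogonal_matrix)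
  moreover have "det Q = 1" using cd by (simp add: Q_def det_2 power2_eq_square)
  ultimately have rot: "rotation_matrix Q" by (simp add: rotation_matrix_def)
  have lin: "linear ((*v) Q)" by (rule matrix_vector_mul_linear)
  have inj: "inj ((*v) Q)"
    using \<open>orthogonal_matrix Q\<close> by (metis orthogonal_matrix_def inj_matrix_vector_mult invertible_def)
  have bij: "bij ((*v) Q)" using inj lin by (simp add: bij_def linear_injective_imp_surjective)
  let ?T = "\<lambda>x. Q *v x + a"
  have T: "?T ` X = (+) a ` ((*v) Q) ` X" for X by (auto simp: image_image add.commute)
  have frontierT: "frontier (?T ` \<Omega>1) = ?T ` frontier \<Omega>1"
  proof -
    have "frontier ((*v) Q ` \<Omega>1) = (*v) Q ` frontier \<Omega>1"
      unfolding frontier_def interior_bijective_linear_image[OF lin bij]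
        closure_injective_linear_image[OF lin inj, symmetric] by (rule image_set_diff[OF inj, symmetric])
    then show ?thesis unfolding T by (simp only: frontier_translation)
  qed
  have range1: "frontier \<Omega>1 = range \<gamma>1"
    using A.on_frontier bij_betw_imp_surj_on[OF A.bij] by blast
  have range2: "frontier \<Omega>2 = range \<gamma>2"
    using B.on_frontier bij_betw_imp_surj_on[OF B.bij] by blast
  have frontiers: "frontier (?T ` \<Omega>1) = frontier \<Omega>2"
    unfolding frontierT range1 range2 by (auto simp: Qv \<gamma>2 image_image)
  obtain vs where vs: "simple_path (polygonal_path vs)" "pathfinish (polygonal_path vs) = pathstart (polygonal_path vs)"
    "path_image (polygonal_path vs) = frontier \<Omega>2"
    using assms(3) by (auto simp: polygon_def)
  have "?T ` \<Omega>1 = \<Omega>2"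
  proof (rule jordan_region_unique)
    have "compact \<Omega>1" using assms(2) by (simp add: polygon_def)
    then show "compact (?T ` \<Omega>1)"
      by (intro compact_continuous_image continuous_intros)
    show "compact \<Omega>2" using assms(3) by (simp add: polygon_def)
    show "interior \<Omega>2 \<noteq> {}" using B.normal_points_inside_outside(1) by blast
    have "interior (?T ` \<Omega>1) = ?T ` interior \<Omega>1"
      unfolding T by (simp only: interior_translation interior_bijective_linear_image[OF lin bij])
    then show "interior (?T ` \<Omega>1) \<noteq> {}" using A.normal_points_inside_outside(1) by blast
  qed (use vs frontiers in auto)
  then show ?thesis using rot by blast
qed

end
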